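(* Let $p$ be an odd prime, $k$ an integer with $1\le k<p/2$, $j$ an integer with $1\le j\le 2k-1$, and $\epsilon\in\mathbb{F}_p^*$. Let $V=[p,k,j,\epsilon]$ and $$H(V)(X)=K_{j+2,2k}X^{p+1}-K_{j+1,2k}X^p+\epsilon\,(K_{1,j}X+K_{1,j-1})\in\mathbb{F}_p[T][X].$$ (1) For each choice of $V$ there are two infinite continued fractions $\alpha$ and $\beta$ in $\mathbb{F}_p((T^{-1}))$, both $P_k$-expansions, such that $H(V)(\alpha)=0$ and $H(V)(1/\beta)=0$. The first one, $\alpha$, is defined by $$\alpha=[w_{j+1}T,w_{j+2}T,\dots,w_{2k}T,\alpha_{2k-j+1}]\quad\text{and}\quad \alpha^p=\epsilon(-1)^{k+j}(P_k\,\alpha_{2k-j+1}-R_k).$$ The second one, $\beta$, is defined by $$\beta=[w_{2k-j+1}T,w_{2k-j+2}T,\dots,w_{2k}T,\beta_{j+1}]\quad\text{and}\quad \beta^p=\epsilon^{-1}(-1)^{k+j}(P_k\,\beta_{j+1}-R_k).$$ (2) Moreover, to each triple $(p,k,j)$ there correspond two different values $\epsilon_A$ and $\epsilon_B$ in $\mathbb{F}_p^*$, namely $$\epsilon_A=(-1)^{k+j+1}[w_{j+1},\dots,w_{2k},\omega_k]\quad\text{and}\quad \epsilon_B=(-1)^{k+j+1}[w_{j+1},\dots,w_{2k}],$$ such that: if $\epsilon=\epsilon_A$, then both $P_k$-expansions $\alpha$ and $\beta$ are perfect of type A; if $\epsilon=\epsilon_B$, then both $P_k$-expansions $\alpha$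 and $\beta$ are perfect of type B. (3) Finally, let $k=(p-1)/2$ and $V=[p,k,j,\epsilon_A]$, and set $P(X)=X^2+2(-1)^jTX+1$. Then $P$ divides $H(V)$, and we have $\alpha=(-1)^j\rho$ and $P(\alpha)=0$, where $\rho=[-2T,2T,-2T,2T,\dots]\in\mathbb{F}_p((T^{-1}))$ is the infinite continued fraction whose partial quotients are alternately $-2T$ and $2T$.
   Context: Let $p$ be an odd prime and $k$ an integer with $1\le k<p/2$. The field $\mathbb{F}_p((T^{-1}))$ of formal power series in $1/T$ carries the usual absolute value with $|T|>1$. Every irrational $\alpha$ with $|\alpha|>1$ has a unique infinite continued fraction expansion $\alpha=[a_1,a_2,\dots]$ with non-constant partial quotients $a_i\in\mathbb{F}_p[T]$; put $\alpha_{n+1}=[a_{n+1},a_{n+2},\dots]$ (the complete quotient), so $\alpha=[a_1,\dots,a_n,\alpha_{n+1}]$. Polynomials and constants. $P_k=(T^2-1)^k$, and $R_k\in\mathbb{F}_p[T]$ is the remainder in the Euclidean division of $T^p$ by $P_k$. Put $\omega_k=(-1)^{k-1}\prod_{1\le i\le k}\bigl(1-\tfrac1{2i}\bigr)\in\mathbb{F}_p^*$. The elements $w_1,\dots,w_{2k}\in\mathbb{F}_p^*$ are defined by $w_1=(2k-1)(2k\omega_k)^{-1}$ and $w_{i+1}w_i=(2k-2i-1)(2k-2i+1)\,(i(2k-i))^{-1}$ for $1\le i\le 2k-1$. Continuants. $\langle\,\rangle=1$, $\langle x_1\rangle=x_1$, $\langle x_1,\dots,x_n\rangle=x_n\langle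 x_1,\dots,x_{n-1}\rangle+\langle x_1,\dots,x_{n-2}\rangle$. For $1\le n\le m\le 2k$, $K_{n,m}=\langle w_nT,w_{n+1}T,\dots,w_mT\rangle\in\mathbb{F}_p[T]$; by convention $K_{n,n-1}=1$ and $K_{n,n-2}=0$. Finite continued fractions of constants. For $c_1,\dots,c_n\in\mathbb{F}_p$, $[c_1,\dots,c_n]=c_1+1/(c_2+1/(\cdots+1/c_n))\in\mathbb{F}_p$; writing this symbol includes the assertion that it is well defined, i.e. $c_n\ne0$, $[c_{n-1},c_n]\neq0$, ..., $[c_2,\dots,c_n]\ne0$. $P_k$-expansions. An infinite continued fraction $\alpha\in\mathbb{F}_p((T^{-1}))$ is a $P_k$-expansion if there are an integer $\ell\ge1$, $(\lambda_1,\dots,\lambda_\ell)\in(\mathbb{F}_p^* )^\ell$ and $(\epsilon_1,\epsilon_2)\in\mathbb{F}_p^*\times\mathbb{F}_p$ with $$\alpha=[\lambda_1T,\dots,\lambda_\ell T,\alpha_{\ell+1}]\quad\text{and}\quad\alpha^p=\epsilon_1P_k\,\alpha_{\ell+1}+\epsilon_2R_k.$$ For any given data $\Lambda=(\lambda_1,\dots,\lambda_\ell,\epsilon_1,\epsilon_2)$ of this kind it is known that there is exactly one infinite continued fraction $\alpha$ with $|\alpha|>1$ satisfying these two conditions; it is the $P_k$-expansion defined by $\Lambda$. Perfect expansions. The $P_k$-expansion defined by $\Lambda=(\lambda_1,\dots,\lambda_\ell,\epsilon_1,\epsilon_2)$ is called perfect of type A if $\epsilon_2\neq0$ and $$[\lambda_\ell,\lambda_{\ell-1},\dots,\lambda_2,\lambda_1-\epsilon_2]=\epsilon_1/(\epsilon_2\omega_k)\quad\text{in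 }\mathbb{F}_p,$$ and perfect of type B if $$[\lambda_\ell,\lambda_{\ell-1},\dots,\lambda_2,\lambda_1-\epsilon_2]=0\quad\text{in }\mathbb{F}_p.$$ (For $\ell=1$ the left-hand side is $\lambda_1-\epsilon_2$.) For the $\alpha$ and $\beta$ of the statement, these conditions refer to the data $\Lambda$ in their displayed definitions: $\Lambda=(w_{j+1},\dots,w_{2k},(-1)^{k+j}\epsilon,-(-1)^{k+j}\epsilon)$ for $\alpha$ and $\Lambda=(w_{2k-j+1},\dots,w_{2k},(-1)^{k+j}\epsilon^{-1},-(-1)^{k+j}\epsilon^{-1})$ for $\beta$. *)

theory Defs
  imports
    "HOL-Computational_Algebra.Computational_Algebra"
    "Berlekamp_Zassenhaus.Finite_Field"
begin

text \<open>
  The field $\mathbb{F}_p$ is \<^typ>\<open>'p::prime_card mod_ring\<close> with $p = |{'p}|$.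
  The field $\mathbb{F}_p((T^{-1}))$ is the type of formal Laurent series in the variable $X = 1/T$,
  so that $T$ is \<^const>\<open>fls_X_inv\<close>, the absolute value of a nonzero series is $|T|$ to minus
  its \<^const>\<open>fls_subdegree\<close>, and the metric of that type induces the usual topology.
  The definitions below make sense over any field and are only used over $\mathbb{F}_p$.
\<close>

definition poly_to_series :: "'a::field poly \<Rightarrow> 'a fls" where
  "poly_to_series q = poly (map_poly fls_const q) fls_X_inv"

text \<open>Value at a series of a polynomial with coefficients in $\mathbb{F}_p[T]$.\<close>

definition eval_series :: "'a::field poly poly \<Rightarrow> 'a fls \<Rightarrow> 'a fls" where
  "eval_series F x = poly (map_poly poly_to_series F) x"

definition P_poly :: "nat \<Rightarrow> 'a::field poly" where
  "P_poly k = ([:0, 1:]\<^sup>2 - 1) ^ k"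

definition R_poly :: "nat \<Rightarrow> nat \<Rightarrow> 'a::field poly" where
  "R_poly p k = [:0, 1:] ^ p mod P_poly k"

definition omega :: "nat \<Rightarrow> 'a::field" where
  "omega k = (- 1) ^ (k - 1) * (\<Prod>i = 1..k. 1 - 1 / of_nat (2 * i))"

text \<open>
  \<open>wcoef k i\<close> is $w_i$, meaningful for $1 \le i \le 2k$; the value at \<open>i = 0\<close> is a dummy.
  The last equation is the relation for $w_{i+1} w_i$, solved for $w_{i+1}$.
\<close>

fun wcoef :: "nat \<Rightarrow> nat \<Rightarrow> 'a::field" where
  "wcoef k 0 = 0"
| "wcoef k (Suc 0) = of_int (2 * int k - 1) / (of_nat (2 * k) * omega k)"
| "wcoef k (Suc (Suc n)) =
     (let i = int (Suc n) in
       of_int ((2 * int k - 2 * i - 1) * (2 * int k - 2 * i + 1))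
         / (of_int (i * (2 * int k - i)) * wcoef k (Suc n)))"

definition w_list :: "nat \<Rightarrow> nat \<Rightarrow> nat \<Rightarrow> 'a::field list" where
  "w_list k n m = map (wcoef k) [n..<Suc m]"

text \<open>
  The recursion for continuants removes entries at the right end, so it is run on the reversed list.
\<close>

fun continuant_rev :: "'a::comm_ring_1 list \<Rightarrow> 'a" where
  "continuant_rev [] = 1"
| "continuant_rev [x] = x"
| "continuant_rev (x # y # xs) = x * continuant_rev (y # xs) + continuant_rev xs"

definition continuant :: "'a::comm_ring_1 list \<Rightarrow> 'a" where
  "continuant xs = continuant_rev (rev xs)"

definition K_poly :: "nat \<Rightarrow> nat \<Rightarrow> nat \<Rightarrow> 'a::field poly" where
  "K_poly k n m = (if m + 2 = n then 0 else continuant (map (\<lambda>c. [:0, c:]) (w_list k n m)))"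

text \<open>
  Finite continued fractions $[c_1,\dots,c_n]$. Division is total, so the assertion that such
  a symbol is well defined is the separate predicate \<open>cfrac_wd\<close>. The empty list is a dummy.
\<close>

fun cfrac :: "'a::field list \<Rightarrow> 'a" where
  "cfrac [] = 0"
| "cfrac [c] = c"
| "cfrac (c # d # cs) = c + 1 / cfrac (d # cs)"

definition cfrac_wd :: "'a::field list \<Rightarrow> bool" where
  "cfrac_wd cs \<longleftrightarrow> cs \<noteq> [] \<and> (\<forall>i. 0 < i \<and> i < length cs \<longrightarrow> cfrac (drop i cs) \<noteq> 0)"

text \<open>
  \<open>infinite_cfrac a x\<close>: $x = [a_1, a_2, \dots]$ with non-constant partial quotients, where
  $a_{i+1}$ is \<open>a i\<close> (indices start at 0). As $a_1$ is non-constant too, this entails $|x| > 1$.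
\<close>

definition infinite_cfrac :: "(nat \<Rightarrow> 'a::field poly) \<Rightarrow> 'a fls \<Rightarrow> bool" where
  "infinite_cfrac a x \<longleftrightarrow>
     (\<forall>i. degree (a i) > 0) \<and>
     (\<lambda>n. cfrac (map (\<lambda>i. poly_to_series (a i)) [0..<Suc n])) \<longlonglongrightarrow> x"

text \<open>
  \<open>P_expansion_by p k ls e\<^sub>1 e\<^sub>2 x\<close>: the tuple $(\lambda_1,\dots,\lambda_\ell,\epsilon_1,\epsilon_2)$,
  where \<open>ls\<close> lists the $\lambda_i$, is admissible data and $x$ satisfies the two defining
  conditions for it. Here \<open>y\<close> is the complete quotient $x_{\ell+1}$.
\<close>

definition P_expansion_by ::
    "nat \<Rightarrow> nat \<Rightarrow> 'a::field list \<Rightarrow> 'a \<Rightarrow> 'a \<Rightarrow> 'a fls \<Rightarrow> bool" where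
  "P_expansion_by p k ls e\<^sub>1 e\<^sub>2 x \<longleftrightarrow>
     ls \<noteq> [] \<and> 0 \<notin> set ls \<and> e\<^sub>1 \<noteq> 0 \<and>
     (\<exists>a y. infinite_cfrac a x \<and>
            infinite_cfrac (\<lambda>i. a (length ls + i)) y \<and>
            (\<forall>i < length ls. a i = [:0, ls ! i:]) \<and>
            x ^ p = fls_const e\<^sub>1 * poly_to_series (P_poly k) * y
                    + fls_const e\<^sub>2 * poly_to_series (R_poly p k))"

definition P_expansion :: "nat \<Rightarrow> nat \<Rightarrow> 'a::field fls \<Rightarrow> bool" where
  "P_expansion p k x \<longleftrightarrow> (\<exists>ls e\<^sub>1 e\<^sub>2. P_expansion_by p k ls e\<^sub>1 e\<^sub>2 x)"

text \<open>The list $\lambda_\ell, \dots, \lambda_2, \lambda_1 - \epsilon_2$ (for nonempty \<open>ls\<close>).\<close>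

definition perfect_list :: "'a::field list \<Rightarrow> 'a \<Rightarrow> 'a list" where
  "perfect_list ls e\<^sub>2 = rev (tl ls) @ [hd ls - e\<^sub>2]"

definition perfect_A :: "nat \<Rightarrow> 'a::field list \<Rightarrow> 'a \<Rightarrow> 'a \<Rightarrow> bool" where
  "perfect_A k ls e\<^sub>1 e\<^sub>2 \<longleftrightarrow>
     e\<^sub>2 \<noteq> 0 \<and> cfrac_wd (perfect_list ls e\<^sub>2) \<and>
     cfrac (perfect_list ls e\<^sub>2) = e\<^sub>1 / (e\<^sub>2 * omega k)"

text \<open>Type B does not involve $k$ and $\epsilon_1$.\<close>

definition perfect_B :: "'a::field list \<Rightarrow> 'a \<Rightarrow> bool" where
  "perfect_B ls e\<^sub>2 \<longleftrightarrow>
     cfrac_wd (perfect_list ls e\<^sub>2) \<and> cfrac (perfect_list ls e\<^sub>2) = 0"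

definition H_poly :: "nat \<Rightarrow> nat \<Rightarrow> nat \<Rightarrow> 'a::field \<Rightarrow> 'a poly poly" where
  "H_poly p k j e =
     Polynomial.monom (K_poly k (j + 2) (2 * k)) (p + 1)
     - Polynomial.monom (K_poly k (j + 1) (2 * k)) p
     + Polynomial.smult [:e:] (Polynomial.monom (K_poly k 1 j) 1 + Polynomial.monom (K_poly k 1 (j - 1)) 0)"

end

theory Submission
  imports Defs
begin

text \<open>
  Up to scaling, the continuants $K_{1,n}$ are the Gegenbauer polynomials of parameter $1/2-k$. Their
  ladder relation yields $K_{1,2k} = (-1)^k P_k$ and $K_{1,2k-1} = -(-1)^k R_k$, hence the symmetry
  $w_{2k+1-i} = -w_i$. Eliminating the complete quotient between the two conditions that define
  $\alpha$ therefore gives $H(V)(\alpha) = 0$, and the symmetry identifies $\beta$ with the $\alpha$ of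
  $(p, k, 2k-j, \epsilon^{-1})$. The finite continued fractions of part (2) have closed forms that are
  rational in $n$ and linear in $w_n$. For $k = (p-1)/2$ one has $w_i = 2(-1)^i$, and
  $(\rho + T)^2 = T^2 - 1$ shows that $(-1)^j\rho$ satisfies the conditions that define $\alpha$.
\<close>

section \<open>The absolute value on formal Laurent series\<close>

text \<open>The inequality 2k < p acts twice: x^p outweighs P_k and R_k near lambda_1 T, which makes
  the defining map a contraction, and the same comparison of degrees excludes rational solutions.
  Irrationality matters because a fixed point alone has no infinite expansion of its complete
  quotient. In characteristic p a differential equation determines a polynomial only up to factors
  in T^p. So K_{1,2k} and K_{1,2k-1} are identified by lifting divisibility by powers of T^2 - 1,
  with degree bounds at the end. The constant in K_{1,2k-1} needs a further argument: R_k is its own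
  inverse modulo P_k, because T^(2p) - 1 = (T^2 - 1)^p, while the determinant identity yields an
  inverse that is a multiple of K_{2,2k}; leading coefficients are then compared. Here the origin of
  omega_k shows: it is minus the binomial coefficient of (p-1)/2 over k, reduced modulo p, and it
  makes w_1 the reciprocal of the leading coefficient of R_k.\<close>

definition fls_abs :: "'a::field fls \<Rightarrow> real" where
  "fls_abs x = dist x 0"

lemma fls_abs_altdef: "fls_abs x = (if x = 0 then 0 else 2 powi (- fls_subdegree x))"
  by (auto simp: fls_abs_def dist_fls_def power_int_def inverse_eq_divide power_one_over)

lemma two_powi_le_iff [simp]: "(2::real) powi m \<le> 2 powi n \<longleftrightarrow> m \<le> n"
  using power_int_increasing[of m n "2::real"] power_int_strict_increasing[of n m "2::real"]
  by (cases "m \<le> n") auto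

lemma dist_conv_fls_abs: "dist x y = fls_abs (x - y)"
  by (simp add: fls_abs_def dist_fls_def)

lemma fls_abs_0 [simp]: "fls_abs 0 = 0"
  and fls_abs_eq_0_iff [simp]: "fls_abs x = 0 \<longleftrightarrow> x = 0"
  and fls_abs_nonneg [simp]: "fls_abs x \<ge> 0"
  and fls_abs_1 [simp]: "fls_abs 1 = 1"
  and fls_abs_X_inv [simp]: "fls_abs fls_X_inv = 2"
  and fls_abs_minus [simp]: "fls_abs (- x) = fls_abs x"
  and fls_abs_const: "c \<noteq> 0 \<Longrightarrow> fls_abs (fls_const c) = 1"
  by (auto simp: fls_abs_altdef)

lemma fls_abs_minus_commute: "fls_abs (x - y) = fls_abs (y - x)"
  using fls_abs_minus[of "x - y"] by simp

lemma fls_abs_pos_iff [simp]: "fls_abs x > 0 \<longleftrightarrow> x \<noteq> 0"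
  using fls_abs_nonneg[of x] fls_abs_eq_0_iff[of x] by linarith

lemma fls_abs_mult: "fls_abs (x * y) = fls_abs x * fls_abs y"
  by (simp add: fls_abs_altdef power_int_add power_int_diff power_int_minus field_simps)

lemma fls_abs_power: "fls_abs (x ^ n) = fls_abs x ^ n"
  by (induction n) (simp_all add: fls_abs_mult)

lemma fls_abs_divide: "fls_abs (x / y) = fls_abs x / fls_abs y"
proof (cases "y = 0")
  case False
  then have "fls_abs (x / y) * fls_abs y = fls_abs x"
    by (simp flip: fls_abs_mult)
  with False show ?thesis by (simp add: field_simps)
qed simp

text \<open>Translates estimates into vanishing coefficients; the ultrametric inequality and
  completeness are then checked coefficient by coefficient.\<close>

lemma fls_abs_le_powi_iff: "fls_abs x \<le> 2 powi (- n) \<longleftrightarrow> (\<forall>k<n.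
    fls_nth x k = 0)"
proof (cases "x = 0")
  case False
  have "fls_abs x \<le> 2 powi (- n) \<longleftrightarrow> n \<le> fls_subdegree x"
    using False by (simp add: fls_abs_altdef)
  also have "\<dots> \<longleftrightarrow> (\<forall>k<n. fls_nth x k = 0)"
    using False fls_subdegree_geI[of x n] by (auto intro: fls_eq0_below_subdegree)
  finally show ?thesis .
qed simp

lemma fls_abs_add_le: "fls_abs (x + y) \<le> max (fls_abs x) (fls_abs y)"
proof -
  consider "x = 0" | "y = 0" | "x \<noteq> 0" "y \<noteq> 0" by blast
  then show ?thesis
  proof cases
    case 3
    define n where "n = min (fls_subdegree x) (fls_subdegree y)"
    have "fls_abs (x + y) \<le> 2 powi (- n)"
      unfolding fls_abs_le_powi_iff by (auto simp: n_def)
    also have "\<dots> = max (fls_abs x) (fls_abs y)"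
      using 3 by (auto simp: n_def fls_abs_altdef min_def max_def)
    finally show ?thesis .
  qed auto
qed

lemma fls_abs_diff_le: "fls_abs (x - y) \<le> max (fls_abs x) (fls_abs y)"
  using fls_abs_add_le[of x "- y"] by simp

lemma fls_abs_diff_triangle: "fls_abs (x - z) \<le> max (fls_abs (x - y)) (fls_abs (y - z))"
  using fls_abs_add_le[of "x - y" "y - z"] by simp

text \<open>The ultrametric inequality is applied twice, the second time to x = (x + y) - y.\<close>

lemma fls_abs_add_eq:
  assumes "fls_abs y < fls_abs x"
  shows "fls_abs (x + y) = fls_abs x"
  using fls_abs_add_le[of x y] fls_abs_diff_le[of "x + y" y] assms by simp

lemma fls_abs_eq_of_diff_less:
  assumes "fls_abs (x - y) < fls_abs x"
  shows "fls_abs y = fls_abs x"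
  using fls_abs_add_eq[of "y - x" x] assms by (simp add: fls_abs_minus_commute)

lemma fls_abs_gt_1_iff: "fls_abs x > 1 \<longleftrightarrow> fls_abs x \<ge> 2"
proof (cases "x = 0")
  case False
  have "1 < fls_abs x \<longleftrightarrow> \<not> 2 powi (- fls_subdegree x) \<le> (2::real) powi 0"
    using False by (simp add: fls_abs_altdef not_le del: two_powi_le_iff)
  also have "\<dots> \<longleftrightarrow> (2::real) powi 1 \<le> 2 powi (- fls_subdegree x)"
    unfolding two_powi_le_iff by linarith
  finally show ?thesis using False by (simp add: fls_abs_altdef)
qed simp

text \<open>The values of \<open>fls_abs\<close> are discrete, so both factors of |xy| are at least
  2. This factor 4 is the source of every contraction and every convergence below.\<close>

lemma fls_abs_inverse_diff_le:
  assumes "fls_abs x > 1" "fls_abs y > 1"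
  shows "fls_abs (1 / x - 1 / y) \<le> fls_abs (x - y) / 4"
proof -
  have xy: "fls_abs x \<ge> 2" "fls_abs y \<ge> 2" using assms by (simp_all add: fls_abs_gt_1_iff)
  then have nz: "x \<noteq> 0" "y \<noteq> 0" by auto
  have "2 * 2 \<le> fls_abs x * fls_abs y" using xy by (intro mult_mono) auto
  then have *: "fls_abs (y - x) * 4 \<le> fls_abs (y - x) * (fls_abs x * fls_abs y)"
    by (intro mult_left_mono) auto
  have "1 / x - 1 / y = (y - x) / (x * y)" using nz by (simp add: field_simps)
  then have "fls_abs (1 / x - 1 / y) = fls_abs (y - x) / (fls_abs x * fls_abs y)"
    by (simp add: fls_abs_divide fls_abs_mult)
  also have "\<dots> \<le> fls_abs (y - x) / 4"
    using * nz by (simp add: divide_simps)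
  finally show ?thesis by (simp add: fls_abs_minus_commute)
qed

text \<open>Completeness in explicit form: the coefficient at i is frozen as soon as n > i.\<close>

lemma fls_limit_exists:
  fixes X :: "nat \<Rightarrow> 'a::field fls"
  assumes X: "\<And>n. fls_abs (X (Suc n) - X n) \<le> (1 / 2) ^ n"
  shows "\<exists>L. X \<longlonglongrightarrow> L \<and> (\<forall>n. fls_abs (L - X n) \<le> (1 /
      2) ^ n)"
proof -
  have half: "(1 / 2 :: real) ^ n = 2 powi (- int n)" for n
    by (simp add: power_int_minus power_one_over field_simps)
  have stable: "fls_nth (X (n + m)) i = fls_nth (X n) i" if "i < int n" for n m i
  proof (induction m)
    case (Suc m)
    have "\<forall>k<int (n + m). fls_nth (X (Suc (n + m)) - X (n + m)) k = 0"
      using X[of "n + m"] unfolding half fls_abs_le_powi_iff .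
    with that Suc show ?case by simp
  qed simp
  \<comment> \<open>\<open>nat (i + 1)\<close> is the least n with i < n; for negative i it is
    0.\<close>
  define g where "g = (\<lambda>i. fls_nth (X (nat (i + 1))) i)"
  have g: "g i = fls_nth (X n) i" if "i < int n" for i n
    using stable[of i "nat (i + 1)" "n - nat (i + 1)"] stable[of i n "nat (i + 1) - n"] that
    by (cases "nat (i + 1) \<le> n") (auto simp: g_def)
  have "\<forall>\<^sub>\<infinity>n::nat. g (- int n) = 0"
  proof -
    have "\<forall>\<^sub>\<infinity>n::nat. fls_nth (X 1) (- int n) = 0" by simp
    \<comment> \<open>The indices -n include 0, hence \<open>X 1\<close> and not \<open>X 0\<close>;
      that a single series supplies all of them makes \<open>Abs_fls g\<close> a genuine Laurent
      series.\<close>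
    moreover have "g (- int n) = fls_nth (X 1) (- int n)" for n by (rule g) simp
    ultimately show ?thesis by simp
  qed
  then have nth: "fls_nth (Abs_fls g) i = g i" for i by simp
  have le: "fls_abs (Abs_fls g - X n) \<le> (1 / 2) ^ n" for n
    unfolding half fls_abs_le_powi_iff using nth g[of _ n] by simp
  have "X \<longlonglongrightarrow> Abs_fls g"
  proof (rule tendstoI)
    fix e :: real assume "e > 0"
    then have "eventually (\<lambda>n. (1 / 2) ^ n < e) sequentially"
      using order_tendstoD(2)[OF LIMSEQ_realpow_zero[of "1/2"]] by simp
    then show "eventually (\<lambda>n. dist (X n) (Abs_fls g) < e) sequentially"
    proof eventually_elim
      case (elim n)
      then show ?case using le[of n] by (simp add: dist_conv_fls_abs fls_abs_minus_commute)
    qed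
  qed
  with le show ?thesis by blast
qed

section \<open>Polynomials in T as Laurent series in 1/T\<close>

lemma poly_to_series_pCons:
  "poly_to_series (pCons c q) = fls_const c + fls_X_inv * poly_to_series q"
  by (cases "pCons c q = 0") (auto simp: poly_to_series_def)

lemma poly_to_series_0 [simp]: "poly_to_series 0 = 0"
  by (simp add: poly_to_series_def)

lemma poly_to_series_const: "poly_to_series [:c:] = fls_const c"
  by (simp add: poly_to_series_pCons)

lemma poly_to_series_1 [simp]: "poly_to_series 1 = 1"
  unfolding one_pCons by (simp add: poly_to_series_const)

lemma poly_to_series_add: "poly_to_series (q + r) = poly_to_series q + poly_to_series r"
proof (induction q r rule: poly_induct2)
  case (pCons a p b q)
  then show ?case by (simp add: poly_to_series_pCons algebra_simps fls_plus_const)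
qed simp

lemma poly_to_series_smult: "poly_to_series (Polynomial.smult c q) = fls_const c * poly_to_series q"
  by (induction q) (simp_all add: poly_to_series_pCons algebra_simps fls_const_mult_const)

lemma poly_to_series_minus: "poly_to_series (- q) = - poly_to_series q"
  using poly_to_series_add[of q "- q"] by (simp add: eq_neg_iff_add_eq_0 add.commute)

lemma poly_to_series_diff: "poly_to_series (q - r) = poly_to_series q - poly_to_series r"
  using poly_to_series_add[of q "- r"] by (simp add: poly_to_series_minus)

lemma poly_to_series_mult: "poly_to_series (q * r) = poly_to_series q * poly_to_series r"
  by (induction q)
     (simp_all add: poly_to_series_pCons poly_to_series_add poly_to_series_smult algebra_simps)

lemma poly_to_series_power: "poly_to_series (q ^ n) = poly_to_series q ^ n"
  by (induction n) (simp_all add: poly_to_series_mult)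

lemmas poly_to_series_hom =
  poly_to_series_add poly_to_series_diff poly_to_series_minus poly_to_series_mult
  poly_to_series_power poly_to_series_smult poly_to_series_const

text \<open>In the Horner form c + T q with q nonzero, the second term has absolute value at least 2
  and dominates the constant.\<close>

lemma fls_abs_poly_to_series:
  "q \<noteq> 0 \<Longrightarrow> fls_abs (poly_to_series q) = 2 ^ degree q"
proof (induction q)
  case (pCons a q)
  show ?case
  proof (cases "q = 0")
    case True
    with pCons.hyps show ?thesis by (simp add: poly_to_series_const fls_abs_const)
  next
    case False
    have a: "fls_abs (fls_const a) \<le> 1" by (cases "a = 0") (simp_all add: fls_abs_const)
    have q: "fls_abs (fls_X_inv * poly_to_series q) = 2 ^ Suc (degree q)"
      using pCons.IH False by (simp add: fls_abs_mult)
    have "(1::real) < 2 ^ Suc (degree q)" by (rule one_less_power) auto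
    with a q have "fls_abs (fls_X_inv * poly_to_series q + fls_const a) = 2 ^ Suc (degree q)"
      by (subst fls_abs_add_eq) auto
    with False show ?thesis by (simp add: poly_to_series_pCons add.commute)
  qed
qed simp

lemma poly_to_series_eq_0_iff [simp]: "poly_to_series q = 0 \<longleftrightarrow> q = 0"
proof
  assume "poly_to_series q = 0"
  then show "q = 0" using fls_abs_poly_to_series[of q] by (cases "q = 0") auto
qed simp

lemma poly_to_series_eq_iff [simp]: "poly_to_series q = poly_to_series r \<longleftrightarrow> q = r"
  using poly_to_series_eq_0_iff[of "q - r"] by (simp add: poly_to_series_diff del:
      poly_to_series_eq_0_iff)

lemma fls_abs_poly_to_series_gt_1:
  "degree q > 0 \<Longrightarrow> fls_abs (poly_to_series q) > 1"
  by (subst fls_abs_poly_to_series) (auto intro: one_less_power)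

lemma polynomial_part_exists:
  fixes x :: "'a::field fls"
  shows "\<exists>q. fls_abs (x - poly_to_series q) < 1"
proof -
  \<comment> \<open>The series variable is 1/T, so T^i has the coefficient at index -i. Coefficients
    at indices below -n vanish, also when the subdegree is positive and n = 0.\<close>
  define n where "n = nat (- fls_subdegree x)"
  define q where "q = (\<Sum>i\<le>n. Polynomial.monom (fls_nth x (- int i)) i)"
  have mon: "poly_to_series (Polynomial.monom c i) = fls_const c * fls_X_inv ^ i" for c :: 'a and i
    by (induction i) (simp_all add: monom_0 monom_Suc poly_to_series_pCons)
  have "poly_to_series q = (\<Sum>i\<le>n. fls_const (fls_nth x (- int i)) * fls_X_inv ^ i)"
  proof -
    have "poly_to_series (sum f A) = (\<Sum>i\<in>A. poly_to_series (f i))" for f :: "nat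
        \<Rightarrow> 'a poly" and A
      by (induction A rule: infinite_finite_induct) (simp_all add: poly_to_series_add)
    then show ?thesis by (simp add: q_def mon)
  qed
  then have q: "fls_nth (poly_to_series q) k
      = (\<Sum>i\<le>n. fls_nth x (- int i) * (if k = - int i then 1 else 0))" for k
    by (simp add: fls_nth_sum)
  have "fls_nth (x - poly_to_series q) k = 0" if "k < 1" for k
  proof (cases "nat (- k) \<le> n")
    case True
    have "fls_nth (poly_to_series q) k = (\<Sum>i\<le>n. if i = nat (- k) then fls_nth x k else 0)"
      unfolding q using that by (intro sum.cong) auto
    with True show ?thesis by simp
  next
    case False
    then have "k < fls_subdegree x" by (auto simp: n_def)
    moreover have "fls_nth (poly_to_series q) k = 0"
      unfolding q using False by (intro sum.neutral) auto
    ultimately show ?thesis by simp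
  qed
  then have "fls_abs (x - poly_to_series q) \<le> 2 powi (- 1)"
    unfolding fls_abs_le_powi_iff by blast
  also have "(2::real) powi (- 1) < 1" by (simp add: power_int_minus)
  finally show ?thesis by blast
qed

section \<open>Infinite continued fractions\<close>

definition cf_convergent :: "(nat \<Rightarrow> 'a::field poly) \<Rightarrow> nat \<Rightarrow> 'a
    fls" where
  "cf_convergent a n = cfrac (map (\<lambda>i. poly_to_series (a i)) [0..<Suc n])"

lemma infinite_cfrac_iff:
  "infinite_cfrac a x \<longleftrightarrow> (\<forall>i. degree (a i) > 0) \<and> cf_convergent a
      \<longlonglongrightarrow> x"
  by (simp add: infinite_cfrac_def cf_convergent_def[abs_def])

lemma cf_convergent_0: "cf_convergent a 0 = poly_to_series (a 0)"
  by (simp add: cf_convergent_def)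

lemma cf_convergent_Suc:
  "cf_convergent a (Suc n) = poly_to_series (a 0) + 1 / cf_convergent (\<lambda>i. a (Suc i)) n"
proof -
  have "[0..<Suc (Suc n)] = 0 # map Suc [0..<Suc n]"
    by (metis map_Suc_upt upt_conv_Cons zero_less_Suc)
  moreover obtain c cs where cs: "[0..<Suc n] = c # cs" by (metis neq_Nil_conv upt_eq_Nil_conv
      not_less_zero zero_less_Suc nat.simps(3) linorder_not_le)
  ultimately show ?thesis unfolding cf_convergent_def by (simp add: cs o_def del: upt.simps)
qed

lemma fls_abs_add_inverse:
  assumes "degree q > 0" "fls_abs z > 1"
  shows "fls_abs (poly_to_series q + 1 / z) = 2 ^ degree q"
    and "fls_abs (poly_to_series q + 1 / z) > 1"
proof -
  have q: "fls_abs (poly_to_series q) = 2 ^ degree q"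
    using assms by (intro fls_abs_poly_to_series) auto
  have "fls_abs (1 / z) < 1" using assms(2) by (simp add: fls_abs_divide divide_simps)
  then have "fls_abs (1 / z) < fls_abs (poly_to_series q)"
    using fls_abs_poly_to_series_gt_1[OF assms(1)] by linarith
  then show "fls_abs (poly_to_series q + 1 / z) = 2 ^ degree q"
    by (subst fls_abs_add_eq) (simp_all add: q)
  then show "fls_abs (poly_to_series q + 1 / z) > 1"
    using fls_abs_poly_to_series_gt_1[OF assms(1)] q by simp
qed

lemma fls_abs_convergent:
  assumes "\<And>i. degree (a i) > 0"
  shows "fls_abs (cf_convergent a n) = 2 ^ degree (a 0)" and "fls_abs (cf_convergent a n) > 1"
proof -
  have "fls_abs (cf_convergent a n) = 2 ^ degree (a 0) \<and> fls_abs (cf_convergent a n) > 1"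
    using assms
  proof (induction n arbitrary: a)
    case 0
    then show ?case
      using fls_abs_poly_to_series[of "a 0"] fls_abs_poly_to_series_gt_1[of "a 0"]
      by (metis cf_convergent_0 degree_0 less_irrefl)
  next
    case (Suc n)
    then show ?case
      using fls_abs_add_inverse[of "a 0" "cf_convergent (\<lambda>i. a (Suc i)) n"]
      by (auto simp: cf_convergent_Suc)
  qed
  then show "fls_abs (cf_convergent a n) = 2 ^ degree (a 0)" and "fls_abs (cf_convergent a n) > 1"
    by auto
qed

text \<open>Nonzero absolute values are locally constant: one term closer to L than c already has
  the absolute value of L.\<close>

lemma fls_abs_tendsto_unique:
  assumes "X \<longlonglongrightarrow> (L :: 'a::field fls)" "\<And>n. fls_abs (X n) = c" "c > 0"
  shows "fls_abs L = c"
proof -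
  have "eventually (\<lambda>n. dist (X n) L < c) sequentially"
    using assms by (intro tendstoD)
  then obtain n where "fls_abs (X n - L) < fls_abs (X n)"
    using assms(2) by (auto simp: dist_conv_fls_abs eventually_sequentially)
  then show ?thesis using fls_abs_eq_of_diff_less assms(2) by metis
qed

lemma fls_abs_infinite_cfrac:
  assumes "infinite_cfrac a x"
  shows "fls_abs x = 2 ^ degree (a 0)" and "fls_abs x > 1"
proof -
  have d: "degree (a i) > 0" for i
    using assms by (simp add: infinite_cfrac_iff)
  have "cf_convergent a \<longlonglongrightarrow> x"
    using assms by (simp add: infinite_cfrac_iff)
  then show x: "fls_abs x = 2 ^ degree (a 0)"
    by (rule fls_abs_tendsto_unique) (simp_all add: fls_abs_convergent(1) d)
  show "fls_abs x > 1"
    using one_less_power[of "2::real" "degree (a 0)"] d[of 0] x by simp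
qed

lemma tendsto_of_dist_le:
  assumes "X \<longlonglongrightarrow> L" "\<And>n. dist (Y n) M \<le> dist (X n) L"
  shows "Y \<longlonglongrightarrow> M"
proof (rule tendstoI)
  fix e :: real assume "e > 0"
  with assms(1) have "eventually (\<lambda>n. dist (X n) L < e) sequentially" by (rule tendstoD)
  then show "eventually (\<lambda>n. dist (Y n) M < e) sequentially"
    by eventually_elim (use assms(2) in \<open>auto intro: le_less_trans\<close>)
qed

text \<open>On |z| > 1 the map z -> a_1 + 1/z does not increase distances, so it may be interchanged
  with the limit.\<close>

lemma infinite_cfrac_cons:
  assumes "degree (a 0) > 0" "infinite_cfrac (\<lambda>i. a (Suc i)) y"
  shows "infinite_cfrac a (poly_to_series (a 0) + 1 / y)"
proof -
  have d': "degree (a (Suc i)) > 0" for i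
    using assms(2) by (simp add: infinite_cfrac_iff)
  have lim: "cf_convergent (\<lambda>i. a (Suc i)) \<longlonglongrightarrow> y"
    using assms(2) by (simp add: infinite_cfrac_iff)
  have d: "degree (a i) > 0" for i using assms(1) d' by (cases i) auto
  have "(\<lambda>n. cf_convergent a (Suc n)) \<longlonglongrightarrow> poly_to_series (a 0) + 1 / y"
  proof (rule tendsto_of_dist_le[OF lim])
    fix n
    have "fls_abs (1 / cf_convergent (\<lambda>i. a (Suc i)) n - 1 / y) 
        \<le> fls_abs (cf_convergent (\<lambda>i. a (Suc i)) n - y) / 4"
      using fls_abs_convergent(2)[OF d'] fls_abs_infinite_cfrac(2)[OF assms(2)]
      by (intro fls_abs_inverse_diff_le) auto
    also have "\<dots> \<le> fls_abs (cf_convergent (\<lambda>i. a (Suc i)) n - y)" by simp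
    finally show "dist (cf_convergent a (Suc n)) (poly_to_series (a 0) + 1 / y)
        \<le> dist (cf_convergent (\<lambda>i. a (Suc i)) n) y"
      by (simp add: dist_conv_fls_abs cf_convergent_Suc)
  qed
  then show ?thesis using d by (simp add: infinite_cfrac_iff filterlim_sequentially_Suc)
qed

lemma infinite_cfrac_unique: "infinite_cfrac a x \<Longrightarrow> infinite_cfrac a y
    \<Longrightarrow> x = y"
  unfolding infinite_cfrac_def using LIMSEQ_unique by blast

text \<open>[c_1, ..., c_n, y] seen as a map of the complete quotient y. The fold makes the empty
  prefix the identity, which suits induction on the prefix.\<close>

definition cfrac_append :: "'a::field list \<Rightarrow> 'a \<Rightarrow> 'a" where
  "cfrac_append cs y = foldr (\<lambda>c z. c + 1 / z) cs y"

lemma cfrac_append_Nil [simp]: "cfrac_append [] y = y"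
  and cfrac_append_Cons [simp]: "cfrac_append (c # cs) y = c + 1 / cfrac_append cs y"
  by (simp_all add: cfrac_append_def)

lemma infinite_cfrac_append:
  assumes "\<And>i. degree (a i) > 0" "infinite_cfrac (\<lambda>i. a (n + i)) y"
  shows "infinite_cfrac a (cfrac_append (map (\<lambda>i. poly_to_series (a i)) [0..<n]) y)"
  using assms
proof (induction n arbitrary: a)
  case (Suc n)
  have eq: "[0..<Suc n] = 0 # map Suc [0..<n]"
    by (metis map_Suc_upt upt_conv_Cons zero_less_Suc)
  have "infinite_cfrac (\<lambda>i. a (Suc i))
      (cfrac_append (map (\<lambda>i. poly_to_series (a (Suc i))) [0..<n]) y)"
    using Suc.IH[of "\<lambda>i. a (Suc i)"] Suc.prems by simp
  then show ?case
    unfolding eq using infinite_cfrac_cons[of a] Suc.prems(1) by (simp add: o_def)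
qed simp

text \<open>Every further quotient shrinks the distance of consecutive convergents by a factor of at
  least 4.\<close>

lemma infinite_cfrac_exists:
  assumes "\<And>i. degree (a i) > 0"
  shows "\<exists>x. infinite_cfrac a x"
proof -
  have "fls_abs (cf_convergent a (Suc n) - cf_convergent a n) \<le> (1 / 2) ^ n" for n
    using assms
  proof (induction n arbitrary: a)
    case 0
    have "fls_abs (cf_convergent (\<lambda>i. a (Suc i)) 0) > 1"
      using 0 by (intro fls_abs_convergent) auto
    then show ?case by (simp add: cf_convergent_Suc cf_convergent_0 fls_abs_divide divide_simps)
  next
    case (Suc n)
    let ?b = "\<lambda>i. a (Suc i)"
    have "fls_abs (cf_convergent a (Suc (Suc n)) - cf_convergent a (Suc n))
        = fls_abs (1 / cf_convergent ?b (Suc n) - 1 / cf_convergent ?b n)"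
      by (simp add: cf_convergent_Suc[of a])
    also have "\<dots> \<le> fls_abs (cf_convergent ?b (Suc n) - cf_convergent ?b n) / 4"
      using Suc.prems by (intro fls_abs_inverse_diff_le fls_abs_convergent) auto
    also have "\<dots> \<le> (1 / 2) ^ n / 4" using Suc.IH[of ?b] Suc.prems by auto
    also have "\<dots> \<le> (1 / 2) ^ Suc n" by simp
    finally show ?case .
  qed
  from fls_limit_exists[OF this] assms show ?thesis
    by (auto simp: infinite_cfrac_iff)
qed

section \<open>Rational series and the continued fraction algorithm\<close>

definition fls_rational :: "'a::field fls \<Rightarrow> bool" where
  "fls_rational x \<longleftrightarrow> (\<exists>q r. r \<noteq> 0 \<and> poly_to_series r * x =
      poly_to_series q)"

text \<open>Used through its contrapositive: irrationality passes from a series to its complete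
  quotients.\<close>

lemma fls_rational_add_inverse:
  assumes "fls_rational z"
  shows "fls_rational (poly_to_series c + 1 / z)"
proof (cases "z = 0")
  case True
  have "poly_to_series 1 * poly_to_series c = poly_to_series c" by simp
  then show ?thesis unfolding fls_rational_def True by (intro exI[of _ c] exI[of _ 1]) simp
next
  case False
  from assms obtain q r where "r \<noteq> 0" and eq: "poly_to_series r * z = poly_to_series q"
    by (auto simp: fls_rational_def)
  with False have "poly_to_series q \<noteq> 0" by (metis mult_eq_0_iff poly_to_series_eq_0_iff)
  moreover have "poly_to_series q * (poly_to_series c + 1 / z) = poly_to_series (q * c + r)"
    using False by (simp add: poly_to_series_hom field_simps flip: eq)
  ultimately show ?thesis unfolding fls_rational_def by auto
qed

lemma fls_rational_cfrac_append:
  "fls_rational y \<Longrightarrow> fls_rational (cfrac_append (map poly_to_series qs) y)"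
  by (induction qs) (auto intro: fls_rational_add_inverse)

text \<open>The continued fraction algorithm: split off the polynomial part and invert the rest.
  Irrationality keeps every remainder nonzero, so the algorithm never stops.\<close>

lemma infinite_cfrac_of_irrational:
  fixes x :: "'a::field fls"
  assumes "\<not> fls_rational x" "fls_abs x > 1"
  shows "\<exists>a. infinite_cfrac a x"
proof -
  define pp where "pp = (\<lambda>x::'a fls. SOME q. fls_abs (x - poly_to_series q) < 1)"
  define nxt where "nxt = (\<lambda>x. 1 / (x - poly_to_series (pp x)))"
  have pp: "fls_abs (x - poly_to_series (pp x)) < 1" for x
    unfolding pp_def using someI_ex[OF polynomial_part_exists] .
  have nxt: "\<not> fls_rational (nxt x) \<and> fls_abs (nxt x) > 1 \<and> degree (pp x) > 0
      \<and> x = poly_to_series (pp x) + 1 / nxt x"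
    if x: "\<not> fls_rational x" "fls_abs x > 1" for x
  proof -
    have eq: "x = poly_to_series (pp x) + 1 / nxt x" by (simp add: nxt_def)
    then have irr: "\<not> fls_rational (nxt x)" using fls_rational_add_inverse x(1) by metis
    have "fls_rational (poly_to_series (pp x))"
      unfolding fls_rational_def by (intro exI[of _ "pp x"] exI[of _ 1]) simp
    with x(1) have "x \<noteq> poly_to_series (pp x)" by metis
    then have "x - poly_to_series (pp x) \<noteq> 0" by simp
    then have gt: "fls_abs (nxt x) > 1" using pp[of x] by (simp add: nxt_def fls_abs_divide)
    have abs: "fls_abs (poly_to_series (pp x)) = fls_abs x"
      using pp[of x] x(2) by (intro fls_abs_eq_of_diff_less) simp
    then have "pp x \<noteq> 0" using x(2) by auto
    with abs x(2) have "2 ^ degree (pp x) > (1::real)" by (simp add: fls_abs_poly_to_series)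
    then have "degree (pp x) > 0" by (cases "degree (pp x)") auto
    with irr gt eq show ?thesis by blast
  qed
  define X where "X = (\<lambda>n. (nxt ^^ n) x)"
  define a where "a = (\<lambda>n. pp (X n))"
  have X: "\<not> fls_rational (X n) \<and> fls_abs (X n) > 1" for n
    by (induction n) (use assms nxt in \<open>auto simp: X_def\<close>)
  have step: "degree (a n) > 0" "X n = poly_to_series (a n) + 1 / X (Suc n)" for n
    using nxt[of "X n"] X[of n] by (auto simp: a_def X_def)
  have d: "degree (a (m + i)) > 0" for m i by (rule step)
  \<comment> \<open>The complete quotient and its convergent pass through the same inversion, which
    gains a factor 4. The index m is free because the induction moves on to the next complete
    quotient.\<close>
  have close: "fls_abs (X m - cf_convergent (\<lambda>i. a (m + i)) n) \<le> (1 / 2) ^ n" for m n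
  proof (induction n arbitrary: m)
    case 0
    then show ?case using pp[of "X m"] by (simp add: cf_convergent_0 a_def)
  next
    case (Suc n)
    let ?b = "\<lambda>i. a (Suc m + i)"
    have "X m - cf_convergent (\<lambda>i. a (m + i)) (Suc n) = 1 / X (Suc m) - 1 / cf_convergent ?b n"
      by (simp add: cf_convergent_Suc step(2)[of m])
    also have "fls_abs \<dots> \<le> fls_abs (X (Suc m) - cf_convergent ?b n) / 4"
      using X[of "Suc m"] fls_abs_convergent(2)[of ?b, OF d]
      by (intro fls_abs_inverse_diff_le) auto
    also have "\<dots> \<le> (1 / 2) ^ n / 4" using Suc.IH[of "Suc m"] by simp
    also have "\<dots> \<le> (1 / 2) ^ Suc n" by simp
    finally show ?case .
  qed
  have "(\<lambda>n. (1 / 2 :: real) ^ n) \<longlonglongrightarrow> 0" by (rule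
      LIMSEQ_realpow_zero) auto
  then have "cf_convergent a \<longlonglongrightarrow> x"
    by (rule tendsto_of_dist_le)
       (use close[of 0] in \<open>simp add: dist_conv_fls_abs fls_abs_minus_commute[of _ x] X_def
           dist_real_def\<close>)
  with step(1) show ?thesis by (auto simp: infinite_cfrac_iff)
qed

section \<open>Existence and uniqueness of \<open>P\<^sub>k\<close>-expansions\<close>

lemma degree_P_poly: "degree (P_poly k :: 'a::field poly) = 2 * k"
  and lead_coeff_P_poly: "lead_coeff (P_poly k :: 'a::field poly) = 1"
  and P_poly_nz: "P_poly k \<noteq> (0 :: 'a::field poly)"
proof -
  have eq: "[:0, 1:]\<^sup>2 - 1 = ([:- 1, 0, 1:] :: 'a poly)"
    by (simp add: power2_eq_square one_pCons)
  show "degree (P_poly k :: 'a poly) = 2 * k" "P_poly k \<noteq> (0 :: 'a poly)"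
    by (simp_all add: P_poly_def eq degree_power_eq)
  show "lead_coeff (P_poly k :: 'a poly) = 1"
    unfolding P_poly_def eq lead_coeff_power by simp
qed

lemma degree_R_poly_less:
  assumes "k > 0"
  shows "degree (R_poly p k :: 'a::field poly) < 2 * k"
  using degree_mod_less[of "P_poly k :: 'a poly" "[:0, 1:] ^ p"] assms
  by (simp add: P_poly_nz degree_P_poly R_poly_def) fastforce

lemma fls_abs_cfrac_append:
  assumes "\<forall>q\<in>set qs. degree q > 0" "fls_abs y > 1"
  shows "fls_abs (cfrac_append (map poly_to_series qs) y) > 1"
  using assms by (induction qs) (auto intro: fls_abs_add_inverse(2))

text \<open>Determines the ball around the first quotient on which the defining map of a
  P_k-expansion is iterated.\<close>

lemma fls_abs_cfrac_append_diff_hd: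
  assumes "\<forall>q\<in>set (q # qs). degree q > 0" "fls_abs y > 1"
  shows "fls_abs (cfrac_append (map poly_to_series (q # qs)) y - poly_to_series q) < 1"
  using fls_abs_cfrac_append[of qs y] assms by (simp add: fls_abs_divide divide_simps)

text \<open>One factor 1/4 comes from the outermost inversion; the inner ones are only used as
  non-expanding, which lets the induction start at the empty prefix.\<close>

lemma cfrac_append_contraction:
  assumes "\<forall>q\<in>set qs. degree q > 0" "fls_abs y > 1" "fls_abs z > 1"
  shows "fls_abs (cfrac_append (map poly_to_series qs) y - cfrac_append (map poly_to_series qs) z)
    \<le> (if qs = [] then 1 else 1 / 4) * fls_abs (y - z)"
  using assms(1)
proof (induction qs)
  case (Cons q qs)
  let ?f = "cfrac_append (map poly_to_series qs)"
  have "fls_abs (1 / ?f y - 1 / ?f z) \<le> fls_abs (?f y - ?f z) / 4"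
    using Cons.prems assms by (intro fls_abs_inverse_diff_le fls_abs_cfrac_append) auto
  also have "fls_abs (?f y - ?f z) \<le> fls_abs (y - z)"
    using Cons fls_abs_nonneg[of "y - z"] by (auto split: if_splits simp del: fls_abs_nonneg)
  finally show ?case by simp
qed simp

abbreviation linear_quotients :: "'a::field list \<Rightarrow> 'a fls list" where
  "linear_quotients ls \<equiv> map poly_to_series (map (\<lambda>c. [:0, c:]) ls)"

lemma P_expansion_by_imp:
  assumes "P_expansion_by p k ls e\<^sub>1 e\<^sub>2 x"
  shows "\<exists>y. fls_abs y > 1 \<and> x = cfrac_append (linear_quotients ls) y \<and>
      x ^ p = fls_const e\<^sub>1 * poly_to_series (P_poly k) * y + fls_const e\<^sub>2 *
          poly_to_series (R_poly p k)"
proof -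
  from assms obtain a y where ax: "infinite_cfrac a x"
    and ay: "infinite_cfrac (\<lambda>i. a (length ls + i)) y"
    and hd: "\<forall>i < length ls. a i = [:0, ls ! i:]"
    and eq: "x ^ p = fls_const e\<^sub>1 * poly_to_series (P_poly k) * y
      + fls_const e\<^sub>2 * poly_to_series (R_poly p k)"
    by (auto simp: P_expansion_by_def)
  have "map (\<lambda>i. poly_to_series (a i)) [0..<length ls] = linear_quotients ls"
    by (rule nth_equalityI) (simp_all add: hd)
  moreover have "infinite_cfrac a (cfrac_append (map (\<lambda>i. poly_to_series (a i)) [0..<length
      ls]) y)"
    using ax ay by (intro infinite_cfrac_append) (auto simp: infinite_cfrac_def)
  ultimately have "x = cfrac_append (linear_quotients ls) y"
    using infinite_cfrac_unique[OF ax] by simp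
  with fls_abs_infinite_cfrac(2)[OF ay] eq show ?thesis by blast
qed

lemma P_expansion_byI:
  assumes "ls \<noteq> []" "0 \<notin> set ls" "e\<^sub>1 \<noteq> 0"
    and x: "x = cfrac_append (linear_quotients ls) y" and y: "infinite_cfrac b y"
    and eq: "x ^ p = fls_const e\<^sub>1 * poly_to_series (P_poly k) * y
      + fls_const e\<^sub>2 * poly_to_series (R_poly p k)"
  shows "P_expansion_by p k ls e\<^sub>1 e\<^sub>2 x"
proof -
  define a where "a = (\<lambda>i. if i < length ls then [:0, ls ! i:] else b (i - length ls))"
  have tl: "(\<lambda>i. a (length ls + i)) = b" by (simp add: a_def)
  have "map (\<lambda>i. poly_to_series (a i)) [0..<length ls] = linear_quotients ls"
    by (rule nth_equalityI) (simp_all add: a_def)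
  moreover have "degree (a i) > 0" for i
    using y assms(2) by (auto simp: a_def infinite_cfrac_def in_set_conv_nth)
  ultimately have "infinite_cfrac a x"
    using infinite_cfrac_append[of a "length ls" y] y by (simp add: tl x)
  then show ?thesis
    unfolding P_expansion_by_def using assms tl by (auto simp: a_def intro!: exI[of _ a])
qed

text \<open>Frobenius, applied to the sum (x - y) + y so that no p-th power of a sign
  appears.\<close>

lemma fls_power_card_diff:
  fixes x y :: "'p::prime_card mod_ring fls"
  shows "(x - y) ^ CARD('p) = x ^ CARD('p) - y ^ CARD('p)"
proof -
  have "CHAR('p mod_ring fls) = CARD('p)"
    by (rule CHAR_eq_posI)
       (simp_all add: fls_of_nat of_nat_eq_0_iff_char_dvd nat_dvd_not_less)
  then have "(x - y + y) ^ CARD('p) = (x - y) ^ CARD('p) + y ^ CARD('p)"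
    by (intro freshmans_dream) (simp_all add: prime_card)
  then show ?thesis by simp
qed

lemma fls_rational_coprime:
  fixes x :: "'p::prime_card mod_ring fls"
  assumes "fls_rational x"
  obtains q r where "r \<noteq> 0" "coprime q r" "poly_to_series r * x = poly_to_series q"
proof -
  from assms obtain q r where "r \<noteq> 0" and eq: "poly_to_series r * x = poly_to_series q"
    by (auto simp: fls_rational_def)
  from \<open>r \<noteq> 0\<close> obtain g q' r' where qr: "q = q' * g" "r = r' * g" "coprime q' r'"
    using gcd_coprime_exists[of q r] by auto
  with \<open>r \<noteq> 0\<close> have "g \<noteq> 0" "r' \<noteq> 0" by auto
  have "poly_to_series g * (poly_to_series r' * x) = poly_to_series g * poly_to_series q'"
    using eq by (simp add: qr poly_to_series_mult mult_ac)
  with \<open>g \<noteq> 0\<close> have "poly_to_series r' * x = poly_to_series q'" by simp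
  with qr \<open>r' \<noteq> 0\<close> that[of r' q'] show thesis by blast
qed

text \<open>Let x = q/r = a + 1/z with a linear. As |x| = 2, the degree of q exceeds that of r by
  one, and r is a numerator of z. So each linear quotient lowers the degree of the numerator by
  exactly one.\<close>

lemma rational_cfrac_append_quotient:
  fixes x :: "'a::field fls"
  assumes "0 \<notin> set ls" "fls_abs y > 1" "x = cfrac_append (linear_quotients ls) y"
    and "r \<noteq> 0" "poly_to_series r * x = poly_to_series q"
  shows "\<exists>q' r'. r' \<noteq> 0 \<and> poly_to_series r' * y = poly_to_series q' \<and>
    degree q' + length ls = degree q"
  using assms
proof (induction ls arbitrary: x q r)
  case Nil
  then show ?case by auto
next
  case (Cons c ls)
  define z where "z = cfrac_append (linear_quotients ls) y"
  have z: "fls_abs z > 1"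
    unfolding z_def using Cons.prems by (intro fls_abs_cfrac_append) auto
  then have z0: "z \<noteq> 0" by auto
  have x: "x = poly_to_series [:0, c:] + 1 / z" using Cons.prems by (simp add: z_def)
  have "fls_abs x = 2"
    unfolding x using fls_abs_add_inverse(1)[of "[:0, c:]" z] z Cons.prems(1) by auto
  moreover have "fls_abs (poly_to_series r) * fls_abs x = fls_abs (poly_to_series q)"
    using Cons.prems(5) by (metis fls_abs_mult)
  moreover from calculation have "q \<noteq> 0" using Cons.prems(4) by auto
  ultimately have "(2::real) ^ Suc (degree r) = 2 ^ degree q"
    using Cons.prems(4) by (simp add: fls_abs_poly_to_series)
  then have deg: "degree q = Suc (degree r)" by (metis numeral_eq_one_iff power_inject_exp
      one_less_numeral_iff semiring_norm(76))
  have eq: "poly_to_series (q - [:0, c:] * r) * z = poly_to_series r"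
    using z0 unfolding poly_to_series_diff poly_to_series_mult Cons.prems(5)[symmetric]
    by (simp add: x field_simps)
  then have "q - [:0, c:] * r \<noteq> 0"
    using Cons.prems(4) by (metis mult_zero_left poly_to_series_0 poly_to_series_eq_0_iff)
  then obtain q' r' where "r' \<noteq> 0" "poly_to_series r' * y = poly_to_series q'"
      "degree q' + length ls = degree r"
    using Cons.IH[OF _ Cons.prems(2) z_def _ eq] Cons.prems(1) by auto
  with deg show ?case by auto
qed

text \<open>
  If \<open>x = q/r\<close> in lowest terms, then the complete quotient \<open>y\<close> has a
      numerator of degree
  \<open>degree q - length ls\<close>, whereas the equation forces its degree to be at least
  \<open>p * degree q - 2 * k\<close>.
\<close>

lemma P_expansion_irrational:
  fixes x :: "'p::prime_card mod_ring fls"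
  assumes "k > 0" "2 * k < p" "ls \<noteq> []" "0 \<notin> set ls"
    and y: "fls_abs y > 1" and x: "x = cfrac_append (linear_quotients ls) y"
    and eq: "x ^ p = fls_const e\<^sub>1 * poly_to_series (P_poly k) * y
      + fls_const e\<^sub>2 * poly_to_series (R_poly p k)"
  shows "\<not> fls_rational x"
proof
  assume "fls_rational x"
  then obtain q r where r: "r \<noteq> 0" and cop: "coprime q r"
    and qr: "poly_to_series r * x = poly_to_series q"
    by (rule fls_rational_coprime)
  from rational_cfrac_append_quotient[OF assms(4) y x r qr] obtain q' r' where r': "r' \<noteq> 0"
    and qr': "poly_to_series r' * y = poly_to_series q'" and deg: "degree q' + length ls = degree q"
    by blast
  have "fls_abs (poly_to_series r') < fls_abs (poly_to_series q')"
    using y r' by (simp add: fls_abs_mult flip: qr')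
  moreover from this have "q' \<noteq> 0"
    by (metis fls_abs_nonneg fls_abs_0 not_le poly_to_series_0)
  ultimately have deg': "degree r' < degree q'"
    using r' by (simp add: fls_abs_poly_to_series)
  \<comment> \<open>\<open>M\<close> over r' is the right-hand side of the equation, that is,
    x^p.\<close>
  define M where "M = Polynomial.smult e\<^sub>1 (P_poly k) * q' + Polynomial.smult e\<^sub>2
      (R_poly p k) * r'"
  have x0: "x \<noteq> 0" 
    using fls_abs_cfrac_append[of "map (\<lambda>c. [:0, c:]) ls" y] assms x by force
  have M: "poly_to_series M = x ^ p * poly_to_series r'"
    unfolding M_def eq by (simp add: poly_to_series_hom algebra_simps flip: qr')
  then have "M \<noteq> 0" using x0 r' by auto
  have "poly_to_series (r ^ p * M) = (poly_to_series r * x) ^ p * poly_to_series r'"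
    by (simp add: M poly_to_series_hom power_mult_distrib)
  also have "\<dots> = poly_to_series (q ^ p * r')"
    unfolding qr by (simp add: poly_to_series_hom)
  finally have "r ^ p * M = q ^ p * r'" by simp
  \<comment> \<open>Lowest terms are essential here: the whole power q^p has to divide
    \<open>M\<close>, whose degree is at most 2k + deg q'.\<close>
  then have "q ^ p dvd r ^ p * M" by simp
  moreover have "coprime (q ^ p) (r ^ p)" using cop by simp
  ultimately have "q ^ p dvd M" by (simp add: coprime_dvd_mult_right_iff)
  then have "degree (q ^ p) \<le> degree M" using \<open>M \<noteq> 0\<close> by (rule
      dvd_imp_degree_le)
  also have "degree M \<le> 2 * k + degree q'"
    unfolding M_def
  proof (rule degree_add_le)
    show "degree (Polynomial.smult e\<^sub>1 (P_poly k) * q') \<le> 2 * k + degree q'"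
      using degree_smult_le[of e\<^sub>1 "P_poly k"]
      by (intro order.trans[OF degree_mult_le] add_mono) (auto simp: degree_P_poly)
    show "degree (Polynomial.smult e\<^sub>2 (R_poly p k) * r') \<le> 2 * k + degree q'"
      using degree_smult_le[of e\<^sub>2 "R_poly p k"] degree_R_poly_less[OF assms(1), of p, where
          'a = "'p mod_ring"] deg'
      by (intro order.trans[OF degree_mult_le] add_mono) auto
  qed
  finally have "p * degree q \<le> 2 * k + degree q'" by (cases "q = 0") (simp_all add:
      degree_power_eq mult.commute)
  moreover have "p * degree q = (p - 1) * degree q + degree q"
    using assms(2) by (cases p) auto
  moreover have "length ls > 0" using assms(3) by simp
  \<comment> \<open>Since deg q' = deg q - \<open>length ls\<close>, the bound reads (p - 1) deg q
    <= 2k - \<open>length ls\<close>; moreover 2k <= p - 1 and \<open>ls\<close> is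
    nonempty.\<close>
  ultimately have "(p - 1) * degree q < p - 1" using deg assms(2) by linarith
  then have "degree q = 0" by simp
  with deg \<open>length ls > 0\<close> show False by simp
qed

text \<open>
  The expansion is the fixed point of $x \mapsto [\lambda_1T,\dots,\lambda_\ell T, y]$ with
  $y = (x^p - \epsilon_2 R_k)/(\epsilon_1 P_k)$, which is contracting near $\lambda_1T$.
\<close>

theorem P_expansion_exists_unique:
  fixes ls :: "'p::prime_card mod_ring list"
  assumes p: "p = CARD('p)" and k: "k > 0" "2 * k < p" and ls: "ls \<noteq> []" "0 \<notin> set ls"
    and e: "e\<^sub>1 \<noteq> 0"
  shows "\<exists>x. \<forall>x'. P_expansion_by p k ls e\<^sub>1 e\<^sub>2 x'
      \<longleftrightarrow> x' = x"
proof -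
  define Pk where "Pk = fls_const e\<^sub>1 * poly_to_series (P_poly k)"
  define Rk where "Rk = fls_const e\<^sub>2 * poly_to_series (R_poly p k)"
  define g where "g = (\<lambda>x. (x ^ p - Rk) / Pk)"
  define f where "f = (\<lambda>x. cfrac_append (linear_quotients ls) (g x))"
  define x0 where "x0 = poly_to_series [:0, hd ls:]"
  have hd: "hd ls \<noteq> 0" using ls by (metis hd_in_set)
  have absPk: "fls_abs Pk = 2 ^ (2 * k)"
    using e by (simp add: Pk_def fls_abs_mult fls_abs_const fls_abs_poly_to_series P_poly_nz
        degree_P_poly)
  then have Pk0: "Pk \<noteq> 0" by auto
  have absRk: "fls_abs Rk < 2 ^ (2 * k)"
    using degree_R_poly_less[OF k(1), of p, where 'a = "'p mod_ring"]
    by (cases "e\<^sub>2 = 0"; cases "R_poly p k = (0 :: 'p mod_ring poly)")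
       (auto simp: Rk_def fls_abs_mult fls_abs_const fls_abs_poly_to_series)
  have absx0: "fls_abs x0 = 2" using hd by (simp add: x0_def fls_abs_poly_to_series)
  have lin: "\<forall>q\<in>set (map (\<lambda>c. [:0, c:]) ls). degree q > 0" using ls by auto
  \<comment> \<open>On this ball |x| = |lambda_1 T| = 2, so |x^p| is constant.\<close>
  define D where "D = (\<lambda>x. fls_abs (x - x0) \<le> 1)"
  have g: "fls_abs (g x) > 1" if "D x" for x
  proof -
    have "fls_abs x = 2"
      using fls_abs_eq_of_diff_less[of x0 x] that absx0 by (simp add: D_def fls_abs_minus_commute)
    then have xp: "fls_abs (x ^ p) = 2 ^ p" by (simp add: fls_abs_power)
    \<comment> \<open>Here 2k < p enters: x^p outweighs R_k, and after division by P_k the absolute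
      value still exceeds 1.\<close>
    have less: "(2::real) ^ (2 * k) < 2 ^ p" using k by (intro power_strict_increasing) auto
    have "fls_abs (x ^ p + - Rk) = 2 ^ p"
      using absRk xp less by (subst fls_abs_add_eq) (simp_all del: power_strict_increasing_iff)
    with absPk less show ?thesis by (simp add: g_def fls_abs_divide divide_simps)
  qed
  have f: "D (f x)" if "D x" for x
    using fls_abs_cfrac_append_diff_hd[of "[:0, hd ls:]" "map (\<lambda>c. [:0, c:]) (tl ls)" "g
        x"] g[OF that] lin ls
    by (cases ls) (auto simp: D_def f_def x0_def)
  have contr: "fls_abs (f x - f y) \<le> fls_abs (x - y) / 2" if "D x" "D y" for x y
  proof -
    have xy: "fls_abs (x - y) \<le> 1"
      using fls_abs_diff_triangle[of x y x0] that by (simp add: D_def fls_abs_minus_commute)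
    have "fls_abs (f x - f y) \<le> 1 / 4 * fls_abs (g x - g y)"
      unfolding f_def using cfrac_append_contraction[OF lin g[OF that(1)] g[OF that(2)]] ls by simp
    \<comment> \<open>R_k cancels, and Frobenius leaves a pure p-th power, which cannot expand
      because |x - y| <= 1.\<close>
    also have "g x - g y = (x - y) ^ p / Pk"
      unfolding p g_def fls_power_card_diff using Pk0 by (simp add: field_simps)
    also have "fls_abs ((x - y) ^ p / Pk) = fls_abs (x - y) ^ p / 2 ^ (2 * k)"
      by (simp add: fls_abs_divide fls_abs_power absPk)
    also have "\<dots> \<le> fls_abs (x - y) ^ 1 / 1"
      using xy k by (intro frac_le power_decreasing) auto
    finally show ?thesis using fls_abs_nonneg[of "x - y"] by (simp del: fls_abs_nonneg)
  qed
  have fixed_iff: "f x = x \<longleftrightarrow> x = cfrac_append (linear_quotients ls) (g x)" for x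
    by (auto simp: f_def)
  have g_iff: "x ^ p = Pk * y + Rk \<longleftrightarrow> y = g x" for x y
    using Pk0 by (auto simp: g_def field_simps)
  define X where "X = (\<lambda>n. (f ^^ n) x0)"
  have DX: "D (X n)" for n
  proof (induction n)
    case 0
    then show ?case by (simp add: X_def D_def)
  next
    case (Suc n)
    then show ?case using f by (simp add: X_def)
  qed
  have "fls_abs (X (Suc n) - X n) \<le> (1 / 2) ^ n" for n
  proof (induction n)
    case 0
    then show ?case using DX[of 1] by (simp add: X_def D_def)
  next
    case (Suc n)
    have "fls_abs (f (X (Suc n)) - f (X n)) \<le> fls_abs (X (Suc n) - X n) / 2"
      by (intro contr DX)
    with Suc show ?case by (simp add: X_def)
  qed
  then obtain x where lim: "X \<longlonglongrightarrow> x" and close: "\<And>n. fls_abs (x - X n)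
      \<le> (1 / 2) ^ n"
    using fls_limit_exists[of X] by blast
  have Dx: "D x" using close[of 0] by (simp add: D_def X_def)
  have "(\<lambda>n. X (Suc n)) \<longlonglongrightarrow> f x"
  proof (rule tendsto_of_dist_le[OF lim])
    fix n
    have "fls_abs (f (X n) - f x) \<le> fls_abs (X n - x) / 2" by (intro contr DX Dx)
    then show "dist (X (Suc n)) (f x) \<le> dist (X n) x"
      using fls_abs_nonneg[of "X n - x"] by (simp add: dist_conv_fls_abs X_def del: fls_abs_nonneg)
  qed
  then have "X \<longlonglongrightarrow> f x" by (simp add: filterlim_sequentially_Suc)
  with lim have fx: "f x = x" using LIMSEQ_unique by blast
  have x_eq: "x = cfrac_append (linear_quotients ls) (g x)" "x ^ p = Pk * g x + Rk"
    using fx fixed_iff g_iff by blast+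
  \<comment> \<open>The complete quotient \<open>g x\<close> is so far just a series; irrationality
    provides its infinite expansion.\<close>
  have "\<not> fls_rational x"
    using P_expansion_irrational[OF k ls g[OF Dx] x_eq(1)] x_eq(2) unfolding Pk_def Rk_def by blast
  then have "\<not> fls_rational (g x)" using x_eq(1) fls_rational_cfrac_append by metis
  then obtain b where "infinite_cfrac b (g x)" using infinite_cfrac_of_irrational g[OF Dx] by blast
  then have px: "P_expansion_by p k ls e\<^sub>1 e\<^sub>2 x"
    using P_expansion_byI[OF ls e x_eq(1)] x_eq(2) unfolding Pk_def Rk_def by blast
  have "x' = x" if "P_expansion_by p k ls e\<^sub>1 e\<^sub>2 x'" for x'
  proof -
    from P_expansion_by_imp[OF that] obtain y where y: "fls_abs y > 1"
      "x' = cfrac_append (linear_quotients ls) y" "x' ^ p = Pk * y + Rk"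
      unfolding Pk_def Rk_def by blast
    then have "f x' = x'" using g_iff unfolding f_def by metis
    \<comment> \<open>Every solution has first quotient lambda_1 T and lies in the same ball, so the
      contraction compares it with x.\<close>
    have "D x'"
      using fls_abs_cfrac_append_diff_hd[of "[:0, hd ls:]" "map (\<lambda>c. [:0, c:]) (tl ls)" y]
          y lin ls
      by (cases ls) (auto simp: D_def x0_def)
    then have "fls_abs (x' - x) \<le> fls_abs (x' - x) / 2"
      using contr[OF _ Dx, of x'] \<open>f x' = x'\<close> fx by simp
    then have "fls_abs (x' - x) \<le> 0" by simp
    then show ?thesis using fls_abs_nonneg[of "x' - x"] by (simp del: fls_abs_nonneg)
  qed
  with px show ?thesis by blast
qed

section \<open>Continuants\<close>

declare wcoef.simps [simp del] mult_pCons_left [simp del] mult_pCons_right [simp del]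

abbreviation poly_T :: "'a::field poly" where "poly_T \<equiv> [:0, 1:]"

lemma K_poly_same: "K_poly k n n = [:0, wcoef k n:]"
  and K_poly_Suc_left: "K_poly k (Suc n) n = 1"
  and K_poly_Suc_Suc_left: "K_poly k (Suc (Suc n)) n = 0"
  by (simp_all add: K_poly_def w_list_def continuant_def)

text \<open>The boundary case n = m + 2 is what the conventions K_{n,n-1} = 1 and K_{n,n-2} = 0
  provide.\<close>

lemma K_poly_rec:
  assumes "n \<le> Suc (Suc m)"
  shows "K_poly k n (Suc (Suc m))
    = [:0, wcoef k (Suc (Suc m)):] * K_poly k n (Suc m) + K_poly k n m"
proof (cases "n = Suc (Suc m)")
  case True
  then show ?thesis by (simp only: K_poly_same K_poly_Suc_left K_poly_Suc_Suc_left) simp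
next
  case False
  with assms have "n \<le> Suc m" by simp
  then show ?thesis by (simp add: K_poly_def w_list_def continuant_def)
qed

text \<open>As functions of the right end, all three continuants obey the same linear recurrence, so
  two consecutive lengths decide.\<close>

lemma K_poly_rec_left:
  "K_poly k (Suc n) (Suc n + d) = [:0, wcoef k (Suc n):] * K_poly k (Suc (Suc n)) (Suc n + d)
    + K_poly k (Suc (Suc (Suc n))) (Suc n + d)"
proof (induction d rule: induct_nat_012)
  case 0
  then show ?case by (simp add: K_poly_same K_poly_Suc_left K_poly_Suc_Suc_left)
next
  case 1
  then show ?case by (simp add: K_poly_same K_poly_Suc_left K_poly_rec mult.commute)
next
  case (ge2 d)
  have rec: "K_poly k m (Suc n + Suc (Suc d)) = [:0, wcoef k (Suc n + Suc (Suc d)):] * K_poly k m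
      (Suc n + Suc d)
      + K_poly k m (Suc n + d)" if "m \<le> Suc (Suc (Suc n))" for m
    using that by (simp add: K_poly_rec)
  have le: "Suc n \<le> Suc (Suc (Suc n))" "Suc (Suc n) \<le> Suc (Suc (Suc n))" by simp_all
  show ?case
    unfolding rec[OF le(1)] rec[OF le(2)] rec[OF order.refl] ge2.IH by (simp only: algebra_simps)
qed

text \<open>The Casoratian of two solutions of one three-term recurrence; it changes sign at each
  step and starts from K_{r+2,r} = 0, K_{r+2,r+1} = 1. With r = 0 it inverts R_k modulo P_k; for
  general r it expresses K_{1,r} through P_k and R_k.\<close>

lemma K_poly_det:
  "K_poly k 1 (Suc (r + d)) * K_poly k (Suc (Suc r)) (r + d)
    - K_poly k 1 (r + d) * K_poly k (Suc (Suc r)) (Suc (r + d))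
    = (- 1) ^ Suc d * (K_poly k 1 r :: 'a::field poly)"
proof (induction d)
  case 0
  then show ?case by (simp add: K_poly_Suc_left K_poly_Suc_Suc_left)
next
  case (Suc d)
  have rec: "(K_poly k 1 (Suc (Suc (r + d))) :: 'a poly) = [:0, wcoef k (Suc (Suc (r + d))):] *
      K_poly k 1 (Suc (r + d))
      + K_poly k 1 (r + d)"
    "(K_poly k (Suc (Suc r)) (Suc (Suc (r + d))) :: 'a poly)
      = [:0, wcoef k (Suc (Suc (r + d))):] * K_poly k (Suc (Suc r)) (Suc (r + d)) + K_poly k (Suc
          (Suc r)) (r + d)"
    by (rule K_poly_rec; simp)+
  have "K_poly k 1 (Suc (r + Suc d)) * K_poly k (Suc (Suc r)) (r + Suc d)
      - K_poly k 1 (r + Suc d) * K_poly k (Suc (Suc r)) (Suc (r + Suc d))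
    = - ((K_poly k 1 (Suc (r + d)) :: 'a poly) * K_poly k (Suc (Suc r)) (r + d)
      - K_poly k 1 (r + d) * K_poly k (Suc (Suc r)) (Suc (r + d)))"
    unfolding add_Suc_right rec by (simp add: algebra_simps)
  also have "\<dots> = - ((- 1) ^ Suc d * K_poly k 1 r)"
    by (rule arg_cong[OF Suc.IH])
  also have "\<dots> = (- 1) ^ Suc (Suc d) * K_poly k 1 r" by simp
  finally show ?case .
qed

lemma degree_K_poly_le: "degree (K_poly k (Suc r) (r + d) :: 'a::field poly) \<le> d"
  and coeff_K_poly: "poly.coeff (K_poly k (Suc r) (r + d) :: 'a::field poly) d = (\<Prod>i=Suc r..r
      + d. wcoef k i)"
proof -
  have "degree (K_poly k (Suc r) (r + d) :: 'a poly) \<le> d \<and>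
      poly.coeff (K_poly k (Suc r) (r + d) :: 'a poly) d = (\<Prod>i=Suc r..r + d. wcoef k i)"
  proof (induction d rule: induct_nat_012)
    case 0
    then show ?case by (simp add: K_poly_Suc_left)
  next
    case 1
    then show ?case by (simp add: K_poly_same)
  next
    case (ge2 d)
    have "poly.coeff (K_poly k (Suc r) (r + d) :: 'a poly) (Suc (Suc d)) = 0"
      using ge2 by (intro coeff_eq_0) (rule le_less_trans[of _ d], auto)
    then have "poly.coeff (K_poly k (Suc r) (r + Suc (Suc d)) :: 'a poly) (Suc (Suc d))
        = (\<Prod>i=Suc r..r + Suc (Suc d). wcoef k i)"
      using ge2 by (simp add: K_poly_rec mult_pCons_left)
    moreover have "degree (K_poly k (Suc r) (r + Suc (Suc d)) :: 'a poly) \<le> Suc (Suc d)"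
    proof -
      have "degree ([:0, wcoef k (Suc (Suc (r + d))):] * K_poly k (Suc r) (Suc (r + d)) :: 'a poly)
          \<le> Suc (Suc d)"
        using ge2 by (intro order.trans[OF degree_mult_le]) auto
      then show ?thesis using ge2 by (auto simp: K_poly_rec intro!: degree_add_le)
    qed
    ultimately show ?case by blast
  qed
  then show "degree (K_poly k (Suc r) (r + d) :: 'a poly) \<le> d"
    "poly.coeff (K_poly k (Suc r) (r + d) :: 'a poly) d = (\<Prod>i=Suc r..r + d. wcoef k i)" by auto
qed

lemma poly_K_poly_minus: "poly (K_poly k 1 n) (- x) = (- 1) ^ n * poly (K_poly k 1 n) x"
proof (induction n rule: induct_nat_012)
  case 0
  then show ?case by (simp add: K_poly_Suc_left)
next
  case 1
  then show ?case by (simp add: K_poly_same)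
next
  case (ge2 n)
  then show ?case by (simp add: K_poly_rec algebra_simps)
qed

lemma poly_K_poly_0: "poly (K_poly k 1 (2 * n)) 0 = 1"
proof (induction n)
  case 0
  then show ?case by (simp add: K_poly_Suc_left)
next
  case (Suc n)
  then show ?case by (simp add: K_poly_rec)
qed

section \<open>Divisibility by powers of T^2 - 1\<close>

text \<open>T is its own inverse modulo T^2 - 1.\<close>

lemma quadratic_dvd_cancel:
  fixes g :: "'a::field poly"
  assumes "c \<noteq> 0" "poly_T\<^sup>2 - 1 dvd Polynomial.smult c (poly_T * g)"
  shows "poly_T\<^sup>2 - 1 dvd g"
proof -
  have "poly_T\<^sup>2 - 1 dvd poly_T * g" using assms dvd_smult_cancel by blast
  then have "poly_T\<^sup>2 - 1 dvd poly_T * (poly_T * g) - (poly_T\<^sup>2 - 1) * g"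
    by (simp add: dvd_diff)
  also have "poly_T * (poly_T * g) - (poly_T\<^sup>2 - 1) * g = g"
    by (simp add: power2_eq_square algebra_simps)
  finally show ?thesis .
qed

text \<open>The factor Q absorbs the exponent m - 1 of the product rule, so the formula also covers
  m = 0.\<close>

lemma pderiv_quadratic_power_mult:
  fixes g :: "'a::field poly"
  defines "Q \<equiv> poly_T\<^sup>2 - 1"
  shows "Q * pderiv (Q ^ m * g) = Q ^ m * (Polynomial.smult (2 * of_nat m) (poly_T * g) + Q * pderiv g)"
proof (cases m)
  case (Suc n)
  have dQ: "pderiv Q = [:2:] * poly_T"
    by (simp add: Q_def power2_eq_square pderiv_diff pderiv_mult pderiv_pCons mult_pCons_left)
  have sm: "Polynomial.smult a f = [:a:] * f" for a :: 'a and f by (simp add: mult_pCons_left)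
  have "pderiv (Q ^ Suc n * g) = Q ^ Suc n * pderiv g + [:of_nat (Suc n):] * (Q ^ n * ([:2:] *
      poly_T)) * g"
    by (simp only: pderiv_mult pderiv_power_Suc dQ sm ac_simps)
  moreover have "Polynomial.smult (2 * of_nat m) (poly_T * g) = [:of_nat (Suc n):] * ([:2:] *
      (poly_T * g))"
    by (simp add: Suc mult_pCons_left mult.commute del: of_nat_Suc)
  ultimately show ?thesis
    by (simp only: Suc power_Suc distrib_left mult.assoc mult.left_commute) (simp only: ac_simps)
qed simp

section \<open>The coefficients w_i and the ladder relation\<close>

locale odd_char_field =
  fixes k p :: nat and ty :: "'a::field itself"
  assumes char: "CHAR('a) = p" and p: "odd p" and k: "1 \<le> k" "2 * k < p"
begin

lemma of_int_nonzero: "n \<noteq> 0 \<Longrightarrow> \<bar>n\<bar> < int p \<Longrightarrow>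
    of_int n \<noteq> (0 :: 'a)"
  using char dvd_imp_le_int[of n "int p"] by (auto simp: of_int_eq_0_iff_char_dvd)

lemma of_nat_nonzero: "n \<noteq> 0 \<Longrightarrow> n < p \<Longrightarrow> of_nat n \<noteq> (0
    :: 'a)"
  using of_int_nonzero[of "int n"] by simp

lemma odd_offset_nonzero: "\<bar>2 * int k - 2 * int i + c\<bar> < int p \<Longrightarrow> odd c
    \<Longrightarrow> 2 * of_nat k - 2 * of_nat i + of_int c \<noteq> (0 :: 'a)"
proof -
  assume *: "\<bar>2 * int k - 2 * int i + c\<bar> < int p" "odd c"
  have "2 * int k - 2 * int i + c \<noteq> 0" using *(2) by presburger
  from of_int_nonzero[OF this *(1)] show ?thesis by simp
qed

lemma omega_nonzero: "omega k \<noteq> (0 :: 'a)"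
proof -
  have "1 - 1 / of_nat (2 * i) \<noteq> (0 :: 'a)" if "i \<in> {1..k}" for i
  proof -
    have "of_int (2 * int i - 1) \<noteq> (0 :: 'a)" using that k by (intro of_int_nonzero) auto
    then have "of_nat (2 * i) \<noteq> (1 :: 'a)" by simp
    then show ?thesis by (auto simp: eq_divide_eq)
  qed
  then have "(\<Prod>i = 1..k. 1 - 1 / of_nat (2 * i)) \<noteq> (0 :: 'a)"
    by (simp only: prod_zero_iff finite_atLeastAtMost) blast
  then show ?thesis unfolding omega_def by (rule no_zero_divisors[rotated]) simp
qed

abbreviation w :: "nat \<Rightarrow> 'a" where "w \<equiv> wcoef k"

lemma w_nonzero: "1 \<le> i \<Longrightarrow> i \<le> 2 * k \<Longrightarrow> w i \<noteq> 0"
proof (induction i rule: induct_nat_012)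
  case 1
  have "of_int (2 * int k - 1) \<noteq> (0 :: 'a)" "of_nat (2 * k) \<noteq> (0 :: 'a)"
    using k by (intro of_int_nonzero of_nat_nonzero; simp)+
  with omega_nonzero show ?case by (simp add: wcoef.simps)
next
  case (ge2 n)
  have "of_int ((2 * int k - 2 * int (Suc n) - 1) * (2 * int k - 2 * int (Suc n) + 1)) \<noteq> (0
      :: 'a)"
  proof -
    have nz: "2 * int k - 2 * int (Suc n) - 1 \<noteq> 0" "2 * int k - 2 * int (Suc n) + 1 \<noteq>
        0" by presburger+
    have le: "\<bar>2 * int k - 2 * int (Suc n) - 1\<bar> < int p" "\<bar>2 * int k - 2 * int (Suc
        n) + 1\<bar> < int p"
      using ge2.prems k by auto
    show ?thesis
      unfolding of_int_mult mult_eq_0_iff de_Morgan_disj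
      by (intro conjI of_int_nonzero[OF nz(1) le(1)] of_int_nonzero[OF nz(2) le(2)])
  qed
  moreover have "of_int (int (Suc n) * (2 * int k - int (Suc n))) \<noteq> (0 :: 'a)"
    unfolding of_int_mult mult_eq_0_iff de_Morgan_disj
    using ge2 k by (intro conjI of_int_nonzero) auto
  ultimately show ?case using ge2 by (simp add: wcoef.simps Let_def del: of_int_mult of_nat_Suc)
qed simp

lemma w_rel:
  assumes "1 \<le> i" "i < 2 * k"
  shows "w (Suc i) * w i * (of_nat i * (2 * of_nat k - of_nat i))
    = (2 * of_nat k - 2 * of_nat i - 1) * (2 * of_nat k - 2 * of_nat i + 1)"
proof -
  obtain n where i: "i = Suc n" using assms by (cases i) auto
  have "of_int (int i * (2 * int k - int i)) \<noteq> (0 :: 'a)"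
    unfolding of_int_mult mult_eq_0_iff de_Morgan_disj
    using assms k by (intro conjI of_int_nonzero) auto
  moreover have "w i \<noteq> 0" using assms by (intro w_nonzero) auto
  ultimately have "w (Suc i) * w i * of_int (int i * (2 * int k - int i))
      = of_int ((2 * int k - 2 * int i - 1) * (2 * int k - 2 * int i + 1))"
    by (simp add: i wcoef.simps Let_def del: of_int_mult of_nat_Suc)
  then show ?thesis by simp
qed

text \<open>If K_{1,n} = s_n C_n with C_n the Gegenbauer polynomial, this is (2k - n) s_n / s_{n-1},
  the rescaled coefficient of the classical ladder relation. The value at 0 is chosen so that
  \<open>ladder_coeff_eq\<close> and \<open>ladder_coeff_rec\<close> hold there too.\<close>

definition ladder_coeff :: "nat \<Rightarrow> 'a" where
  "ladder_coeff n = (if n = 0 then (1 - 2 * of_nat k) / w 1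
     else w n * (of_nat n * (2 * of_nat k - of_nat n)) / (2 * of_nat n - 2 * of_nat k - 1))"

lemma ladder_coeff_eq:
  assumes "n < 2 * k"
  shows "w (Suc n) * ladder_coeff n = 2 * of_nat n + 1 - 2 * of_nat k"
proof (cases "n = 0")
  case True
  then show ?thesis using w_nonzero[of 1] k by (simp add: ladder_coeff_def)
next
  case False
  have "2 * of_nat k - 2 * of_nat n + of_int 1 \<noteq> (0 :: 'a)"
    using assms k False by (intro odd_offset_nonzero) auto
  then have nz: "2 * of_nat n - 2 * of_nat k - 1 \<noteq> (0 :: 'a)"
    by (simp add: algebra_simps)
  have "w (Suc n) * ladder_coeff n = w (Suc n) * w n * (of_nat n * (2 * of_nat k - of_nat n)) / (2
      * of_nat n - 2 * of_nat k - 1)"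
    using False by (simp add: ladder_coeff_def)
  also have "\<dots> = 2 * of_nat n + 1 - 2 * of_nat k"
    using w_rel[of n] assms False nz by (simp add: divide_simps) (simp add: algebra_simps)
  finally show ?thesis .
qed

lemma ladder_coeff_1: "ladder_coeff 1 = - w 1"
proof -
  have "2 * of_nat k - 2 * of_nat 1 + of_int 1 \<noteq> (0 :: 'a)"
    using k by (intro odd_offset_nonzero) auto
  then have nz: "1 - 2 * of_nat k \<noteq> (0 :: 'a)"
    by (simp add: algebra_simps)
  then show ?thesis by (simp add: ladder_coeff_def divide_simps) (simp add: algebra_simps)
qed

text \<open>Makes the ladder compatible with the recursion of the continuants. Both sides are
  written as multiples of w_{n+2}; a rational identity in n and k remains.\<close>

lemma ladder_coeff_rec:
  assumes "Suc (Suc n) \<le> 2 * k"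
  shows "ladder_coeff (Suc (Suc n)) = ladder_coeff n - w (Suc (Suc n))"
proof -
  let ?n = "of_nat n :: 'a" and ?k = "of_nat k :: 'a"
  have nz1: "2 * ?k - 2 * ?n - 1 \<noteq> 0" "2 * ?k - 2 * ?n - 3 \<noteq> 0"
    using odd_offset_nonzero[of n "- 1"] odd_offset_nonzero[of n "- 3"] assms k by auto
  have nz2: "2 * ?n + 3 - 2 * ?k \<noteq> 0" using nz1(2) by (simp add: algebra_simps)
  have W: "w (Suc (Suc n)) \<noteq> 0" "w (Suc n) \<noteq> 0" using assms by (intro w_nonzero; simp)+
  have h1: "w (Suc n) * ladder_coeff n = - (2 * ?k - 2 * ?n - 1)"
    using ladder_coeff_eq[of n] assms by (simp add: algebra_simps)
  have h2: "w (Suc (Suc n)) * w (Suc n) * ((?n + 1) * (2 * ?k - ?n - 1))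
      = (2 * ?k - 2 * ?n - 3) * (2 * ?k - 2 * ?n - 1)"
    using w_rel[of "Suc n"] assms by (simp add: algebra_simps)
  \<comment> \<open>The relation for w_{n+2} w_{n+1} brings in w_{n+1}, whose product with
    \<open>ladder_coeff n\<close> is known; then 2k - 2n - 1 cancels.\<close>
  have "(2 * ?k - 2 * ?n - 1) * ((2 * ?k - 2 * ?n - 3) * ladder_coeff n)
      = w (Suc (Suc n)) * w (Suc n) * ((?n + 1) * (2 * ?k - ?n - 1)) * ladder_coeff n"
    unfolding h2 by (simp only: mult_ac)
  also have "\<dots> = w (Suc (Suc n)) * ((?n + 1) * (2 * ?k - ?n - 1)) * (w (Suc n) * ladder_coeff n)"
    by (simp only: mult_ac)
  also have "\<dots> = (2 * ?k - 2 * ?n - 1) * (- w (Suc (Suc n)) * ((?n + 1) * (2 * ?k - ?n - 1)))"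
    unfolding h1 by (simp only: mult_minus_left mult_minus_right mult_ac)
  finally have "(2 * ?k - 2 * ?n - 3) * ladder_coeff n = - w (Suc (Suc n)) * ((?n + 1) * (2 * ?k -
      ?n - 1))"
    by (rule mult_left_cancel[OF nz1(1), THEN iffD1])
  then have dn: "ladder_coeff n = - w (Suc (Suc n)) * ((?n + 1) * (2 * ?k - ?n - 1)) / (2 * ?k - 2
      * ?n - 3)"
    using nz1(2) by (simp add: field_simps)
  have "ladder_coeff (Suc (Suc n)) = w (Suc (Suc n)) * ((?n + 2) * (2 * ?k - ?n - 2)) / (2 * ?n + 3
      - 2 * ?k)"
    by (simp add: ladder_coeff_def algebra_simps)
  also have "\<dots> = ladder_coeff n - w (Suc (Suc n))"
    unfolding dn using nz1(2) nz2 by (simp add: divide_simps) (simp add: algebra_simps)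
  finally show ?thesis .
qed

text \<open>
  Up to scaling the continuants are the Gegenbauer polynomials of parameter $1/2 - k$; this is their
  ladder relation, where the factor of \<open>ladder_coeff n\<close> is $K_{1,n-1}$.
\<close>

lemma K_poly_ladder_aux:
  "n \<le> 2 * k \<Longrightarrow> (poly_T\<^sup>2 - 1) * pderiv (K_poly k 1 n) = of_nat n *
      (poly_T * K_poly k 1 n)
       + [:ladder_coeff n:] * (K_poly k 1 (Suc n) - [:w (Suc n):] * (poly_T * K_poly k 1 n))"
proof (induction n rule: induct_nat_012)
  case 0
  then show ?case by (simp add: K_poly_same K_poly_Suc_left mult_pCons_left)
next
  case 1
  then show ?case using ladder_coeff_1
    by (simp add: K_poly_same K_poly_Suc_left K_poly_rec pderiv_pCons power2_eq_square one_pCons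
        mult_pCons_left)
next
  case (ge2 n)
  define Q :: "'a poly" where "Q = poly_T\<^sup>2 - 1"
  define A where "A = (K_poly k 1 n :: 'a poly)"
  define B where "B = (K_poly k 1 (Suc n) :: 'a poly)"
  define u where "u = [:w (Suc (Suc n)):]"
  define v where "v = [:w (Suc n):]"
  define a where "a = [:ladder_coeff n:]"
  define b where "b = [:ladder_coeff (Suc n):]"
  have C: "K_poly k 1 (Suc (Suc n)) = u * (poly_T * B) + A"
    by (simp add: A_def B_def u_def K_poly_rec mult_pCons_left)
  \<comment> \<open>The claim spells K_{1,n-1} as K_{1,n+1} - w_{n+1} T K_{1,n}, which makes sense
    at n = 0 as well; here this is undone for index n + 2.\<close>
  have D: "K_poly k 1 (Suc (Suc (Suc n))) - [:w (Suc (Suc (Suc n))):] * (poly_T * K_poly k 1 (Suc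
      (Suc n))) = B"
    using K_poly_rec[of 1 "Suc n" k, where 'a = 'a] by (simp add: B_def mult_pCons_left)
  have IA: "Q * pderiv A = of_nat n * (poly_T * A) + a * (B - v * (poly_T * A))"
    using ge2 by (simp add: A_def B_def Q_def a_def v_def)
  have IB: "Q * pderiv B = (of_nat n + 1) * (poly_T * B) + b * A"
    using ge2 C by (simp add: A_def B_def Q_def b_def u_def add.commute)
  have "w (Suc (Suc n)) * ladder_coeff (Suc n) = w (Suc n) * ladder_coeff n + 2"
    using ge2 by (simp add: ladder_coeff_eq)
  \<comment> \<open>Consecutive ladder coefficients are tuned so that the terms in T
    \<open>A\<close> add up to the factor n + 2.\<close>
  then have r1: "u * b = v * a + 2"
    by (simp add: u_def v_def a_def b_def mult_pCons_left numeral_poly)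
  have r2: "[:ladder_coeff (Suc (Suc n)):] = a - u" using ladder_coeff_rec[of n] ge2 by (simp add:
      a_def u_def)
  have Q2: "Q * (u * B) = poly_T * (poly_T * (u * B)) - u * B"
    by (simp add: Q_def power2_eq_square algebra_simps)
  have "pderiv (u * (poly_T * B) + A) = u * B + u * (poly_T * pderiv B) + pderiv A"
    by (simp add: u_def pderiv_add pderiv_mult pderiv_pCons algebra_simps)
  then have "Q * pderiv (u * (poly_T * B) + A) = Q * (u * B) + u * (poly_T * (Q * pderiv B)) + Q *
      pderiv A"
    by (simp only: algebra_simps)
  also have "u * (poly_T * (Q * pderiv B)) = (of_nat n + 1) * (u * (poly_T * (poly_T * B))) + (u *
      b) * (poly_T * A)"
    unfolding IB by (simp add: algebra_simps)
  also have "Q * (u * B) + ((of_nat n + 1) * (u * (poly_T * (poly_T * B))) + (u * b) * (poly_T *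
      A)) + Q * pderiv A
      = (of_nat n + 2) * (poly_T * (u * (poly_T * B) + A)) + (a - u) * B"
    unfolding IA Q2 r1 by (simp add: algebra_simps)
  finally show ?case unfolding D unfolding C r2 Q_def by (simp add: add.commute)
qed

lemma K_poly_ladder:
  assumes "Suc n \<le> 2 * k"
  shows "(poly_T\<^sup>2 - 1) * pderiv (K_poly k 1 (Suc n))
    = of_nat (Suc n) * (poly_T * K_poly k 1 (Suc n)) + [:ladder_coeff (Suc n):] * K_poly k 1 n"
proof -
  have "K_poly k 1 (Suc (Suc n)) - [:w (Suc (Suc n)):] * (poly_T * K_poly k 1 (Suc n)) = K_poly k 1 n"
    by (simp add: K_poly_rec mult_pCons_left)
  with K_poly_ladder_aux[OF assms] show ?thesis by simp
qed

end

text \<open>With f = Q^m g, the derivative formula gives Q | 2m T g, hence Q | g as long as 2m is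
  nonzero in the field.\<close>

lemma dvd_power_Suc_of_pderiv:
  fixes f :: "'a::field poly"
  defines "Q \<equiv> poly_T\<^sup>2 - 1"
  assumes m: "2 * of_nat m \<noteq> (0 :: 'a)" and f: "Q ^ m dvd f" "Q ^ m dvd pderiv f"
  shows "Q ^ Suc m dvd f"
proof -
  have Q0: "Q \<noteq> 0" by (simp add: Q_def power2_eq_square one_pCons mult_pCons_left)
  obtain g where g: "f = Q ^ m * g" using f(1) by (elim dvdE)
  obtain h where h: "pderiv f = Q ^ m * h" using f(2) by (elim dvdE)
  have "Q ^ m * (Q * h) = Q * pderiv f" by (simp add: h mult_ac)
  also have "\<dots> = Q ^ m * (Polynomial.smult (2 * of_nat m) (poly_T * g) + Q * pderiv g)"
    unfolding g Q_def by (rule pderiv_quadratic_power_mult)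
  finally have "Q * h = Polynomial.smult (2 * of_nat m) (poly_T * g) + Q * pderiv g"
    using Q0 by simp
  then have "Polynomial.smult (2 * of_nat m) (poly_T * g) = Q * (h - pderiv g)"
    by (simp add: algebra_simps)
  then have "Q dvd Polynomial.smult (2 * of_nat m) (poly_T * g)" by simp
  with m have "Q dvd g" unfolding Q_def by (rule quadratic_dvd_cancel)
  then show ?thesis by (simp add: g mult.commute mult_dvd_mono)
qed

lemma quadratic_dvdI:
  fixes f :: "'a::field poly"
  assumes "poly f 1 = 0" "poly f (- 1) = 0" "(2 :: 'a) \<noteq> 0"
  shows "poly_T\<^sup>2 - 1 dvd f"
proof -
  obtain g where g: "f = [:- 1, 1:] * g" using assms(1) by (auto simp: poly_eq_0_iff_dvd elim!: dvdE)
  with assms(2,3) have "poly g (- 1) = 0" by auto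
  then obtain h where h: "g = [:1, 1:] * h" by (auto simp: poly_eq_0_iff_dvd elim!: dvdE)
  have "poly_T\<^sup>2 - 1 = [:- 1, 1:] * ([:1, 1:] :: 'a poly)"
    by (simp add: power2_eq_square one_pCons mult_pCons_left)
  then have "f = (poly_T\<^sup>2 - 1) * h" by (simp only: g h mult.assoc)
  then show ?thesis by simp
qed

context odd_char_field
begin

lemma two_nonzero: "(2 :: 'a) \<noteq> 0"
  using of_int_nonzero[of 2] k by simp

text \<open>The ladder coefficient vanishes at n = 2k and leaves (T^2 - 1) F' = 2k T F. Divisibility
  by Q^k is lifted from this one power at a time; the degree bound and F(0) = 1 then decide.\<close>

lemma K_poly_full_eq: "K_poly k 1 (2 * k) = (- 1) ^ k * (P_poly k :: 'a poly)"
proof -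
  define Q :: "'a poly" where "Q = poly_T\<^sup>2 - 1"
  define F :: "'a poly" where "F = K_poly k 1 (2 * k)"
  have Q0: "Q \<noteq> 0" by (simp add: Q_def power2_eq_square one_pCons mult_pCons_left)
  have eq: "Q * pderiv F = Polynomial.smult (2 * of_nat k) (poly_T * F)"
  proof -
    have "Suc (2 * k - 1) = 2 * k" using k by simp
    moreover have "ladder_coeff (2 * k) = 0" using k by (simp add: ladder_coeff_def)
    ultimately show ?thesis
      using K_poly_ladder[of "2 * k - 1"] k by (simp add: Q_def F_def of_nat_poly mult_pCons_left)
  qed
  have "Q ^ m dvd F" if "m \<le> k" for m
    using that
  proof (induction m)
    case (Suc m)
    then have "Q ^ m dvd F" by simp
    then obtain g where g: "F = Q ^ m * g" by (elim dvdE)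
    have "Q ^ m * Polynomial.smult (2 * of_nat k) (poly_T * g) = Q * pderiv F"
      unfolding eq by (simp add: g mult_ac)
    also have "\<dots> = Q ^ m * (Polynomial.smult (2 * of_nat m) (poly_T * g) + Q * pderiv g)"
      unfolding g Q_def by (rule pderiv_quadratic_power_mult)
    finally have "Polynomial.smult (2 * of_nat k) (poly_T * g)
        = Polynomial.smult (2 * of_nat m) (poly_T * g) + Q * pderiv g"
      using mult_left_cancel[of "Q ^ m"] Q0 by (metis power_not_zero)
    \<comment> \<open>For m < k the coefficients 2k and 2m differ in the field, which forces another
      factor Q.\<close>
    then have "Polynomial.smult (2 * of_nat k - 2 * of_nat m) (poly_T * g) = Q * pderiv g"
      unfolding smult_diff_left by simp
    then have "Q dvd Polynomial.smult (2 * of_nat k - 2 * of_nat m) (poly_T * g)" by simp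
    moreover have "2 * of_nat k - 2 * of_nat m \<noteq> (0 :: 'a)"
      using of_int_nonzero[of "2 * int k - 2 * int m"] Suc.prems k by simp
    ultimately have "Q dvd g" unfolding Q_def by (rule quadratic_dvd_cancel[rotated])
    then have "Q ^ m * Q dvd Q ^ m * g" by (rule mult_dvd_mono[OF dvd_refl])
    then show ?case by (simp only: g power_Suc2)
  qed simp
  then have "P_poly k dvd F" by (simp add: P_poly_def Q_def)
  then obtain c where c: "F = P_poly k * c" by (elim dvdE)
  have F0: "poly F 0 = 1" unfolding F_def by (rule poly_K_poly_0)
  then have "F \<noteq> 0" by auto
  moreover have "degree F \<le> 2 * k" unfolding F_def using degree_K_poly_le[of k 0 "2 * k"] by simp
  ultimately have "degree c = 0"
    unfolding c by (subst (asm) degree_mult_eq) (auto simp: degree_P_poly P_poly_nz)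
  then obtain a where a: "c = [:a:]" by (rule degree_eq_zeroE)
  have "(- 1) ^ k * a = 1" using F0 by (simp add: c a P_poly_def)
  moreover have "a = (- 1) ^ k * ((- 1) ^ k * a)" by (cases "even k") simp_all
  ultimately have "a = (- 1) ^ k" by simp
  then have "c = (- 1) ^ k" unfolding a
    by (cases "even k") (simp_all add: pCons_one, metis minus_pCons minus_zero pCons_one)
  then show ?thesis using c by (simp add: F_def mult.commute)
qed

text \<open>By Frobenius T^(2p) - 1 = (T^2 - 1)^p. Consequently R_k is its own inverse modulo
  P_k.\<close>

lemma P_dvd_power_p_square: "(P_poly k :: 'a poly) dvd (poly_T ^ p)\<^sup>2 - 1"
proof -
  have ch: "CHAR('a poly) = p" using char by simp
  have "prime p" using char k by (metis prime_CHAR_semidom not_less_zero neq0_conv)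
  have "((poly_T\<^sup>2 - 1) + 1 :: 'a poly) ^ p = (poly_T\<^sup>2 - 1) ^ p + 1 ^ p"
    using ch \<open>prime p\<close> by (intro freshmans_dream) auto
  then have "(poly_T ^ p)\<^sup>2 - 1 = (poly_T\<^sup>2 - 1 :: 'a poly) ^ p"
    by (simp add: power_mult[symmetric] mult.commute)
  then show ?thesis unfolding P_poly_def using k by (simp add: le_imp_power_dvd)
qed

text \<open>F' is divisible by Q^(k-1), and F agrees with t T^p at 1 and -1. As T^p has derivative
  0, Q^k divides the difference, and F has degree below 2k.\<close>

lemma K_poly_eq_smult_R:
  "K_poly k 1 (2 * k - 1) = Polynomial.smult (poly (K_poly k 1 (2 * k - 1)) 1) (R_poly p k :: 'a poly)"
proof -
  define Q :: "'a poly" where "Q = poly_T\<^sup>2 - 1"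
  define F :: "'a poly" where "F = K_poly k 1 (2 * k - 1)"
  define t where "t = poly F 1"
  have Q0: "Q \<noteq> 0" by (simp add: Q_def power2_eq_square one_pCons mult_pCons_left)
  define f where "f = F - Polynomial.smult t (poly_T ^ p)"
  obtain n where n: "2 * k = Suc (Suc n)" using k by (cases "2 * k"; cases "2 * k - 1") auto
  have w2k: "w (2 * k) \<noteq> 0" using k by (intro w_nonzero) auto
  moreover have "w (2 * k) * ladder_coeff (Suc n) = of_nat (Suc n)"
  proof -
    have e: "2 * of_nat k = (of_nat n + 2 :: 'a)"
      using arg_cong[OF n, of "of_nat :: nat \<Rightarrow> 'a"] by simp
    have "w (2 * k) * ladder_coeff (Suc n) = 2 * of_nat (Suc n) + 1 - 2 * of_nat k"
      using ladder_coeff_eq[of "Suc n"] n by simp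
    then show ?thesis unfolding e by simp
  qed
  ultimately have dn: "ladder_coeff (Suc n) = of_nat (Suc n) / w (2 * k)" by (simp add: field_simps)
  \<comment> \<open>At n = 2k - 1 the ladder coefficient is (2k - 1)/w_{2k}, just what the recursion
    needs to merge both terms into K_{1,2k}.\<close>
  have "Q * pderiv F = [:of_nat (Suc n) / w (2 * k):] * K_poly k 1 (2 * k)"
  proof -
    have "Q * pderiv F = of_nat (Suc n) * (poly_T * F) + [:of_nat (Suc n) / w (2 * k):] * K_poly k 1 n"
      using K_poly_ladder[of n] n dn by (simp add: Q_def F_def)
    moreover have "K_poly k 1 (2 * k) = [:w (2 * k):] * (poly_T * F) + K_poly k 1 n"
      using K_poly_rec[of 1 n k, where 'a = 'a] n by (simp add: F_def mult_pCons_left)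
    moreover have "[:of_nat (Suc n) / w (2 * k):] * [:w (2 * k):] = of_nat (Suc n)"
      using w2k by (simp add: mult_pCons_left of_nat_poly)
    ultimately show ?thesis by (simp only: distrib_left mult.assoc[symmetric])
  qed
  also have "K_poly k 1 (2 * k) = Q * ((- 1) ^ k * Q ^ (k - 1))"
    using K_poly_full_eq k power_Suc[of Q "k - 1"] by (simp add: P_poly_def Q_def mult_ac del:
        power_Suc)
  finally have "Q * pderiv F = Q * (Q ^ (k - 1) * ([:of_nat (Suc n) / w (2 * k):] * (- 1) ^ k))"
    by (simp only: mult_ac)
  then have "Q ^ (k - 1) dvd pderiv F" using Q0 by simp
  moreover have "pderiv (Polynomial.smult t (poly_T ^ p)) = (0 :: 'a poly)"
  proof -
    have "of_nat p = (0 :: 'a)" using char by auto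
    then show ?thesis by (cases p) (simp_all add: pderiv_smult pderiv_power_Suc del: of_nat_Suc
        power_Suc)
  qed
  ultimately have deriv: "Q ^ (k - 1) dvd pderiv f" by (simp add: f_def pderiv_diff)
  have "Q dvd f"
    unfolding Q_def
  proof (rule quadratic_dvdI[OF _ _ two_nonzero])
    show "poly f 1 = 0" by (simp add: f_def t_def poly_power)
    have "poly F (- 1) = - t"
      unfolding F_def t_def poly_K_poly_minus using k by simp
    then show "poly f (- 1) = 0" using p by (simp add: f_def poly_power)
  qed
  have "Q ^ Suc m dvd f" if "m < k" for m
    using that
  proof (induction m)
    case (Suc m)
    have "2 * of_nat (Suc m) \<noteq> (0 :: 'a)"
      using two_nonzero of_nat_nonzero[of "Suc m"] Suc.prems k by (simp del: of_nat_Suc)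
    moreover have "Q ^ Suc m dvd pderiv f"
      by (rule dvd_trans[OF le_imp_power_dvd deriv]) (use Suc.prems in simp)
    ultimately show ?case
      using Suc unfolding Q_def by (intro dvd_power_Suc_of_pderiv[of "Suc m"]) auto
  qed (use \<open>Q dvd f\<close> in simp)
  from this[of "k - 1"] have "P_poly k dvd f" using k by (simp add: P_poly_def Q_def)
  then have "F mod P_poly k = Polynomial.smult t (poly_T ^ p) mod P_poly k"
    by (simp add: f_def mod_eq_dvd_iff)
  moreover have "F mod P_poly k = F"
  proof (rule mod_poly_less)
    show "degree F < degree (P_poly k)"
      using degree_K_poly_le[of k 0 "2 * k - 1", where 'a = 'a] k by (simp add: F_def degree_P_poly)
  qed
  ultimately show ?thesis by (simp add: R_poly_def mod_smult_left F_def t_def)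
qed

section \<open>The leading coefficient of R_k and the symmetry of the w_i\<close>

text \<open>As 2h = -1 in the field, h acts as -1/2, and the right side is the generalized binomial
  coefficient of -1/2 over m.\<close>

lemma central_binomial_eq:
  assumes ph: "p = Suc (2 * h)" and "m \<le> h"
  shows "of_nat (h choose m) = (- 1) ^ m * (\<Prod>i = 1..m. 1 - 1 / of_nat (2 * i) :: 'a)"
proof -
  have h: "2 * of_nat h = (- 1 :: 'a)"
  proof -
    have "of_nat (Suc (2 * h)) = (0 :: 'a)" using char ph by (metis of_nat_CHAR)
    then show ?thesis by (simp add: add.commute eq_neg_iff_add_eq_0)
  qed
  show ?thesis
    using \<open>m \<le> h\<close>
  proof (induction m)
    case (Suc m)
    have nz: "of_nat (Suc m) \<noteq> (0 :: 'a)" using Suc.prems ph by (intro of_nat_nonzero) auto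
    have "Suc m * (h choose Suc m) = (h - m) * (h choose m)"
      using Suc.prems by (metis binomial_absorb_comp mult.commute Suc_times_binomial_eq
          binomial_absorption)
    then have "of_nat (Suc m) * of_nat (h choose Suc m) = (of_nat h - of_nat m) * (of_nat (h choose
        m) :: 'a)"
      using Suc.prems by (metis of_nat_mult of_nat_diff Suc_leD)
    then have "2 * (of_nat (Suc m) * of_nat (h choose Suc m)) = (2 * of_nat h - 2 * of_nat m) *
        (of_nat (h choose m) :: 'a)"
      by (simp only: mult.assoc[symmetric] left_diff_distrib right_diff_distrib)
    moreover define z where "z = (of_nat (2 * Suc m) :: 'a)"
    ultimately have "z * of_nat (h choose Suc m) = (1 - z) * of_nat (h choose m)"
      unfolding h by (simp add: algebra_simps)
    moreover have "z \<noteq> 0"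
      unfolding z_def of_nat_mult of_nat_numeral using nz two_nonzero by (rule
          no_zero_divisors[rotated])
    ultimately have "of_nat (h choose Suc m) = - (1 - 1 / z) * of_nat (h choose m)"
      by (simp add: field_simps)
    also have "of_nat (h choose m) = (- 1) ^ m * (\<Prod>i = 1..m. 1 - 1 / of_nat (2 * i) :: 'a)"
      using Suc by simp
    finally show ?case by (simp add: z_def algebra_simps del: of_nat_Suc of_nat_mult)
  qed simp
qed

text \<open>T^p = T (Q + 1)^h; the terms with i >= k are multiples of P_k, the others have degree
  below 2k.\<close>

lemma R_poly_eq_sum:
  assumes ph: "p = Suc (2 * h)"
  shows "R_poly p k = poly_T * (\<Sum>i<k. of_nat (h choose i) * (poly_T\<^sup>2 - 1) ^ i :: 'a poly)"
proof -
  have kh: "k \<le> h" using ph k by simp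
  define Q :: "'a poly" where "Q = poly_T\<^sup>2 - 1"
  have degQ: "degree Q = 2" "poly.coeff (Q ^ i) (2 * i) = 1" for i
    using degree_P_poly[of 1, where 'a = 'a] degree_P_poly[of i, where 'a = 'a]
        lead_coeff_P_poly[of i, where 'a = 'a]
    by (simp_all add: P_poly_def Q_def)
  have "Q \<noteq> 0" using degQ(1) by auto
  then have deg_le: "degree (of_nat a * Q ^ i) \<le> 2 * i" for a i
    using degree_mult_le[of "of_nat a" "Q ^ i"] by (simp add: degree_power_eq degQ(1))
  define S where "S = (\<Sum>i<k. of_nat (h choose i) * Q ^ i)"
  have "poly_T ^ p = poly_T * (Q + 1) ^ h"
    by (simp add: ph Q_def power_mult)
  also have "(Q + 1) ^ h = (\<Sum>i\<le>h. of_nat (h choose i) * Q ^ i)"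
    by (simp add: binomial_ring)
  also have "\<dots> = S + (\<Sum>i\<in>{k..h}. of_nat (h choose i) * Q ^ i)"
  proof -
    have "{..h} = {..<k} \<union> {k..h}" using kh by auto
    then show ?thesis unfolding S_def by (simp add: sum.union_disjoint ivl_disj_int)
  qed
  finally have eq: "poly_T ^ p = poly_T * S + poly_T * (\<Sum>i\<in>{k..h}. of_nat (h choose i) * Q
      ^ i)"
    by (simp only: distrib_left)
  have "P_poly k dvd poly_T * (\<Sum>i\<in>{k..h}. of_nat (h choose i) * Q ^ i)"
    unfolding P_poly_def Q_def[symmetric] by (intro dvd_mult dvd_sum) (simp add: le_imp_power_dvd)
  then have "R_poly p k = (poly_T * S) mod P_poly k"
    unfolding R_poly_def eq by (subst mod_add_right_eq[symmetric]) (simp only: dvd_imp_mod_0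
        add_0_right)
  also have "\<dots> = poly_T * S"
  proof (rule mod_poly_less)
    have "degree S \<le> 2 * (k - 1)"
      unfolding S_def
    proof (rule degree_sum_le)
      fix i assume "i \<in> {..<k}"
      then have "2 * i \<le> 2 * (k - 1)" by auto
      with deg_le show "degree (of_nat (h choose i) * Q ^ i) \<le> 2 * (k - 1)" by (rule order.trans)
    qed simp
    then have "degree (poly_T * S) \<le> 1 + 2 * (k - 1)"
      by (intro order.trans[OF degree_mult_le]) auto
    then show "degree (poly_T * S) < degree (P_poly k)" using k by (simp add: degree_P_poly)
  qed
  finally show ?thesis unfolding S_def Q_def .
qed

text \<open>The leading coefficient of R_k is the binomial coefficient of h over k - 1, and omega_k
  is (2k - 1)/(2k) times it. This accounts for the normalization of w_1.\<close>

lemma coeff_R_poly: "w 1 * poly.coeff (R_poly p k) (2 * k - 1) = 1"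
proof -
  define h where "h = (p - 1) div 2"
  have ph: "p = Suc (2 * h)" using p by (auto simp: h_def elim: oddE)
  have kh: "k \<le> h" using ph k by simp
  define Q :: "'a poly" where "Q = poly_T\<^sup>2 - 1"
  have degQ: "degree (Q ^ i) = 2 * i" "poly.coeff (Q ^ i) (2 * i) = 1" for i
    using degree_P_poly[of i, where 'a = 'a] lead_coeff_P_poly[of i, where 'a = 'a]
    by (simp_all add: P_poly_def Q_def)
  define S where "S = (\<Sum>i<k. of_nat (h choose i) * Q ^ i)"
  have "poly.coeff (R_poly p k) (2 * k - 1) = poly.coeff S (2 * (k - 1))"
    unfolding R_poly_eq_sum[OF ph] S_def Q_def using k by (cases k) (simp_all add: mult_pCons_left)
  also have "S = (\<Sum>i<k - 1. of_nat (h choose i) * Q ^ i) + of_nat (h choose (k - 1)) * Q ^ (k - 1)"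
    unfolding S_def using k by (cases k) simp_all
  also have "poly.coeff \<dots> (2 * (k - 1)) = of_nat (h choose (k - 1))"
  proof -
    have "poly.coeff (of_nat (h choose i) * Q ^ i) (2 * (k - 1)) = 0" if "i < k - 1" for i
      using that degree_mult_le[of "of_nat (h choose i)" "Q ^ i"]
      by (intro coeff_eq_0) (simp add: degQ)
    then have "(\<Sum>i<k - 1. poly.coeff (of_nat (h choose i) * Q ^ i) (2 * (k - 1))) = 0"
      by (intro sum.neutral) simp
    moreover have "poly.coeff (of_nat (h choose (k - 1)) * Q ^ (k - 1)) (2 * (k - 1)) = of_nat (h
        choose (k - 1))"
      by (simp add: of_nat_poly degQ mult_pCons_left)
    ultimately show ?thesis by (simp only: coeff_add coeff_sum add_0_left)
  qed
  finally have c: "poly.coeff (R_poly p k) (2 * k - 1) = (of_nat (h choose (k - 1)) :: 'a)" .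
  have "omega k = of_nat (h choose (k - 1)) * (1 - 1 / of_nat (2 * k) :: 'a)"
    unfolding omega_def using k kh central_binomial_eq[OF ph, of "k - 1"] by (cases k) simp_all
  moreover have k0: "of_nat (2 * k) \<noteq> (0 :: 'a)" "of_int (2 * int k - 1) \<noteq> (0 :: 'a)"
    using k by (intro of_nat_nonzero of_int_nonzero; simp)+
  ultimately have "of_nat (2 * k) * omega k = of_nat (h choose (k - 1)) * (of_int (2 * int k - 1)
      :: 'a)"
    by (simp add: field_simps)
  then show ?thesis
    unfolding c using k0 omega_nonzero by (simp add: wcoef.simps field_simps)
qed

text \<open>Modulo P_k, both R_k and -t K_{2,2k} are inverse to R_k, so by degrees they are equal.
  Their leading coefficients give t = -(-1)^k; those of K_{1,2k-1} and K_{1,2k} then give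
  w_{2k}.\<close>

lemma wcoef_last: "w (2 * k) = - w 1"
  and K_poly_penultimate_eq: "K_poly k 1 (2 * k - 1) = - ((- 1) ^ k * (R_poly p k :: 'a poly))"
proof -
  let ?P = "P_poly k :: 'a poly" and ?R = "R_poly p k :: 'a poly" and ?L = "K_poly k (Suc (Suc 0))
      (2 * k) :: 'a poly"
  define t where "t = poly (K_poly k 1 (2 * k - 1) :: 'a poly) 1"
  define c where "c = poly.coeff ?R (2 * k - 1)"
  have KR: "K_poly k 1 (2 * k - 1) = Polynomial.smult t ?R"
    unfolding t_def by (rule K_poly_eq_smult_R)
  have S: "Suc (2 * k - 1) = 2 * k" using k by simp
  have "K_poly k 1 (2 * k) * K_poly k (Suc (Suc 0)) (2 * k - 1) - K_poly k 1 (2 * k - 1) * ?L = 1"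
    using K_poly_det[of k 0 "2 * k - 1", where 'a = 'a] S
    by (simp add: K_poly_Suc_left del: power_Suc)
  then have "Polynomial.smult t ?R * ?L + 1 = ?P * ((- 1) ^ k * K_poly k (Suc (Suc 0)) (2 * k - 1))"
    unfolding K_poly_full_eq KR by (simp add: algebra_simps)
  then have d1: "?P dvd Polynomial.smult t ?R * ?L + 1" by simp
  have "?P dvd ?R - poly_T ^ p" unfolding R_poly_def by (simp add: mod_eq_dvd_iff[symmetric])
  then have "?P dvd (?R - poly_T ^ p) * (?R + poly_T ^ p) + ((poly_T ^ p)\<^sup>2 - 1)"
    using P_dvd_power_p_square by (intro dvd_add dvd_mult2)
  also have "(?R - poly_T ^ p) * (?R + poly_T ^ p) + ((poly_T ^ p)\<^sup>2 - 1) = ?R * ?R - 1"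
    by (simp add: algebra_simps power2_eq_square)
  finally have d2: "?P dvd ?R * ?R - 1" .
  \<comment> \<open>This combination of the two congruences eliminates the square of R_k.\<close>
  have "?P dvd ?R * (Polynomial.smult t ?R * ?L + 1) - (?R * ?R - 1) * Polynomial.smult t ?L"
    by (rule dvd_diff[OF dvd_mult[OF d1] dvd_mult2[OF d2]])
  also have "?R * (Polynomial.smult t ?R * ?L + 1) - (?R * ?R - 1) * Polynomial.smult t ?L
      = Polynomial.smult t ?L + ?R"
    by (simp add: algebra_simps smult_diff_right)
  finally have "?P dvd Polynomial.smult t ?L + ?R" .
  moreover have "degree (Polynomial.smult t ?L + ?R) < degree ?P"
  proof -
    have "degree ?L \<le> 2 * k - 1" using degree_K_poly_le[of k 1 "2 * k - 1", where 'a = 'a] S by simp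
    then have "degree (Polynomial.smult t ?L) < 2 * k"
      using degree_smult_le[of t ?L] k by linarith
    then show ?thesis using degree_R_poly_less[of k p, where 'a = 'a] k
      by (auto simp: degree_P_poly intro!: degree_add_less)
  qed
  ultimately have eq: "Polynomial.smult t ?L + ?R = 0"
    by (meson dvd_imp_degree_le not_less)
  have "t * (\<Prod>i=Suc (Suc 0)..2 * k. w i) + c = 0"
  proof -
    have "poly.coeff ?L (2 * k - 1) = (\<Prod>i=Suc (Suc 0)..2 * k. w i)"
      using coeff_K_poly[of k 1 "2 * k - 1", where 'a = 'a] S by simp
    then show ?thesis using arg_cong[OF eq, of "\<lambda>f. poly.coeff f (2 * k - 1)"] by (simp
        add: c_def)
  qed
  moreover have "(\<Prod>i=1..2 * k. w i) = (- 1) ^ k"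
  proof -
    have "(\<Prod>i=1..2 * k. w i) = poly.coeff (K_poly k 1 (2 * k)) (2 * k)"
      using coeff_K_poly[of k 0 "2 * k", where 'a = 'a] by simp
    also have "\<dots> = (- 1) ^ k * poly.coeff ?P (2 * k)"
      unfolding K_poly_full_eq by (cases "even k") simp_all
    finally show ?thesis using lead_coeff_P_poly[of k, where 'a = 'a] by (simp add: degree_P_poly)
  qed
  moreover have "(\<Prod>i=1..2 * k. w i) = w 1 * (\<Prod>i=Suc (Suc 0)..2 * k. w i)"
    using k by (simp add: prod.atLeast_Suc_atMost)
  moreover have cw: "w 1 * c = 1" unfolding c_def by (rule coeff_R_poly)
  moreover have "w 1 * (t * (\<Prod>i=Suc (Suc 0)..2 * k. w i) + c)
      = t * (w 1 * (\<Prod>i=Suc (Suc 0)..2 * k. w i)) + w 1 * c"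
    by (simp only: distrib_left mult_ac)
  ultimately have "t * (- 1) ^ k + 1 = 0" by (simp only: mult_zero_right)
  then have t: "t = - ((- 1) ^ k)" by (cases "even k") (auto simp: eq_neg_iff_add_eq_0)
  have "(\<Prod>i=1..2 * k - 1. w i) = t * c"
    using coeff_K_poly[of k 0 "2 * k - 1", where 'a = 'a] KR by (simp add: c_def)
  moreover have "(\<Prod>i=1..2 * k. w i) = (\<Prod>i=1..2 * k - 1. w i) * w (2 * k)"
    using S prod.cl_ivl_Suc[of w 1 "2 * k - 1"] k by simp
  ultimately have "(- 1) ^ k = t * c * w (2 * k)" using \<open>(\<Prod>i=1..2 * k. w i) = (- 1) ^
      k\<close> by simp
  moreover have "c * w (2 * k) = - ((- 1) ^ k * (t * c * w (2 * k)))"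
    unfolding t by (cases "even k") simp_all
  ultimately have "c * w (2 * k) = - ((- 1) ^ k * (- 1) ^ k)" by simp
  then have "c * w (2 * k) = - 1" by (cases "even k") simp_all
  then have "w 1 * c * w (2 * k) = - w 1" by (simp add: mult.assoc)
  then show "w (2 * k) = - w 1" using cw by simp
  show "K_poly k 1 (2 * k - 1) = - ((- 1) ^ k * ?R)"
    unfolding KR t by (cases "even k") simp_all
qed

text \<open>The relation for w_{i+1} w_i is invariant under i -> 2k - i, so the symmetry spreads
  from w_{2k} = -w_1.\<close>

lemma wcoef_sym: "1 \<le> i \<Longrightarrow> i \<le> 2 * k \<Longrightarrow> w (2 * k + 1 - i) = - w i"
proof (induction i rule: nat_induct_at_least)
  case base
  then show ?case using wcoef_last by simp
next
  case (Suc i)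
  let ?i = "of_nat i :: 'a" and ?k = "of_nat k :: 'a"
  have i: "2 * k + 1 - i = Suc (2 * k - i)" "2 * k + 1 - Suc i = 2 * k - i" using Suc by auto
  have nz: "?i * (2 * ?k - ?i) \<noteq> 0"
    using of_int_nonzero[of "int i"] of_int_nonzero[of "2 * int k - int i"] Suc k by auto
  have r1: "w (Suc i) * w i * (?i * (2 * ?k - ?i)) = (2 * ?k - 2 * ?i - 1) * (2 * ?k - 2 * ?i + 1)"
    using Suc by (intro w_rel) auto
  have of2: "of_nat (2 * k - i) = 2 * ?k - ?i" using Suc by (simp add: of_nat_diff)
  have "w (Suc (2 * k - i)) * w (2 * k - i) * (of_nat (2 * k - i) * (2 * ?k - of_nat (2 * k - i)))
      = (2 * ?k - 2 * of_nat (2 * k - i) - 1) * (2 * ?k - 2 * of_nat (2 * k - i) + 1)"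
    using Suc by (intro w_rel) auto
  then have "w (Suc (2 * k - i)) * w (2 * k - i) * (?i * (2 * ?k - ?i)) = w (Suc i) * w i * (?i *
      (2 * ?k - ?i))"
    unfolding r1 of2 by (simp add: algebra_simps)
  then have "w (Suc (2 * k - i)) * w (2 * k - i) = w (Suc i) * w i" using nz by simp
  moreover have "w (Suc (2 * k - i)) = - w i" using Suc i by simp
  moreover have "w i \<noteq> 0" using Suc by (intro w_nonzero) auto
  ultimately have "w i * w (2 * k - i) = w i * (- w (Suc i))"
    by (metis (no_types) minus_minus mult.commute mult_minus_left)
  with \<open>w i \<noteq> 0\<close> have "w (2 * k - i) = - w (Suc i)" by (rule
      mult_left_cancel[THEN iffD1])
  then show ?case using i by simp
qed

text \<open>Reversal matches the left recursion of K_{2k-m+1,2k} with the right recursion of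
  K_{1,m}, each entry changing its sign.\<close>

lemma K_poly_sym: "m \<le> 2 * k \<Longrightarrow> K_poly k (Suc (2 * k - m)) (2 * k) = (- 1) ^ m *
    (K_poly k 1 m :: 'a poly)"
proof (induction m rule: induct_nat_012)
  case 0
  then show ?case by (simp add: K_poly_Suc_left)
next
  case 1
  then show ?case using wcoef_last by (simp add: K_poly_same)
next
  case (ge2 m)
  have e: "Suc (2 * k - m) = Suc (Suc (Suc (2 * k - Suc (Suc m))))"
    "Suc (2 * k - Suc m) = Suc (Suc (2 * k - Suc (Suc m)))" using ge2.prems by auto
  have "K_poly k (Suc (2 * k - Suc (Suc m))) (2 * k)
      = [:0, w (Suc (2 * k - Suc (Suc m))):] * K_poly k (Suc (2 * k - Suc m)) (2 * k) + (K_poly k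
          (Suc (2 * k - m)) (2 * k) :: 'a poly)"
  proof -
    have "Suc (2 * k - Suc (Suc m)) + Suc m = 2 * k" using ge2.prems by simp
    then show ?thesis
      unfolding e using K_poly_rec_left[of k "2 * k - Suc (Suc m)" "Suc m", where 'a = 'a] by metis
  qed
  also have "w (Suc (2 * k - Suc (Suc m))) = - w (Suc (Suc m))"
    using wcoef_sym[of "Suc (Suc m)"] e(2) ge2.prems by simp
  also have "[:0, - w (Suc (Suc m)):] = - [:0, w (Suc (Suc m)):]" by simp
  finally show ?case using ge2 by (simp add: K_poly_rec algebra_simps del: minus_pCons)
qed

end

section \<open>Perfect expansions\<close>

text \<open>Values guessed for all tails are confirmed by one backward recursion. Well-definedness
  then amounts to nonvanishing of \<open>v\<close> at positive positions.\<close>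

lemma cfrac_drop_eq:
  assumes last: "v (length cs - 1) = cs ! (length cs - 1)"
    and step: "\<And>i. Suc i < length cs \<Longrightarrow> v i = cs ! i + 1 / v (Suc i)"
    and i: "i < length cs"
  shows "cfrac (drop i cs) = v i"
proof -
  have "i \<le> length cs - 1" using i by simp
  then show ?thesis
  proof (induction i rule: inc_induct)
    case base
    have "drop (length cs - 1) cs = [cs ! (length cs - 1)]"
      using i Cons_nth_drop_Suc[of "length cs - 1" cs] by (cases cs) auto
    then show ?case using last by simp
  next
    case (step i)
    then have "drop i cs = cs ! i # cs ! Suc i # drop (Suc (Suc i)) cs"
      "drop (Suc i) cs = cs ! Suc i # drop (Suc (Suc i)) cs"
      by (simp_all add: Cons_nth_drop_Suc)
    then show ?case using step.IH assms(2)[of i] step.hyps by simp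
  qed
qed

context odd_char_field
begin

text \<open>With this notation w_{n+1} w_n n (2k - n) =
  \<open>\<delta> n * \<delta> (Suc n)\<close>.\<close>

definition \<delta> :: "nat \<Rightarrow> 'a" where "\<delta> n = 2 * of_nat k - 2 * of_nat n + 1"

lemma \<delta>_nonzero: "1 \<le> n \<Longrightarrow> n \<le> 2 * k \<Longrightarrow> \<delta> n
    \<noteq> 0"
  using odd_offset_nonzero[of n 1] k by (auto simp: \<delta>_def)

text \<open>Turns the reciprocal of one coefficient into a multiple of its neighbour, so the
  continued fraction recursions stay linear in w_n.\<close>

lemma inverse_wcoef:
  assumes "1 \<le> n" "n < 2 * k"
  shows "1 / w (Suc n) = w n * (of_nat n * (2 * of_nat k - of_nat n)) / (\<delta> n * \<delta> (Suc n))"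
    and "1 / w n = w (Suc n) * (of_nat n * (2 * of_nat k - of_nat n)) / (\<delta> n * \<delta> (Suc n))"
proof -
  have "w (Suc n) * w n * (of_nat n * (2 * of_nat k - of_nat n)) = \<delta> n * \<delta> (Suc n)"
    using w_rel[OF assms] by (simp add: \<delta>_def algebra_simps)
  moreover have "w n \<noteq> 0" "w (Suc n) \<noteq> 0" using assms w_nonzero[of n] w_nonzero[of
      "Suc n"] by simp_all
  moreover have "\<delta> n \<noteq> 0" "\<delta> (Suc n) \<noteq> 0" using assms
      \<delta>_nonzero[of n] \<delta>_nonzero[of "Suc n"] by simp_all
  ultimately show "1 / w (Suc n) = w n * (of_nat n * (2 * of_nat k - of_nat n)) / (\<delta> n *
      \<delta> (Suc n))"
    and "1 / w n = w (Suc n) * (of_nat n * (2 * of_nat k - of_nat n)) / (\<delta> n * \<delta> (Suc n))"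
    by (simp_all add: divide_simps mult_ac)
qed

text \<open>
  Closed forms of $[w_n,\dots,w_{2k},\omega_k]$, of $[w_n,\dots,w_{2k}]$, of
      $[w_n,\dots,w_1,-\omega_k]$ and
  of $[w_n,\dots,w_1]$.
\<close>

definition tail_A :: "nat \<Rightarrow> 'a" where "tail_A n = (2 * of_nat k + 1 - of_nat n) /
    \<delta> n * w n"
definition tail_B :: "nat \<Rightarrow> 'a" where "tail_B n = (1 - of_nat n) / \<delta> n * w n"
definition head_A :: "nat \<Rightarrow> 'a" where "head_A n = - of_nat n / \<delta> n * w n"
definition head_B :: "nat \<Rightarrow> 'a" where "head_B n = (2 * of_nat k - of_nat n) / \<delta>
    n * w n"

text \<open>Explains the entry lambda_1 - epsilon_2 of a perfect list: if epsilon_2 is the tail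
  value, this entry is a head value.\<close>

lemma tail_head:
  assumes "1 \<le> n" "n \<le> 2 * k"
  shows "w n - tail_A n = head_A n" "w n - tail_B n = head_B n"
proof -
  have "w n - tail_A n = (\<delta> n - (2 * of_nat k + 1 - of_nat n)) / \<delta> n * w n"
    "w n - tail_B n = (\<delta> n - (1 - of_nat n)) / \<delta> n * w n"
    using \<delta>_nonzero[OF assms]
    by (simp_all add: tail_A_def tail_B_def diff_divide_distrib left_diff_distrib)
  then show "w n - tail_A n = head_A n" "w n - tail_B n = head_B n"
    by (simp_all add: head_A_def head_B_def \<delta>_def)
qed

lemma two_k_minus_nonzero: "n < 2 * k \<Longrightarrow> 2 * of_nat k - of_nat n \<noteq> (0 :: 'a)"
  using of_int_nonzero[of "2 * int k - int n"] k by simp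

lemma tail_A_nonzero: "1 \<le> n \<Longrightarrow> n \<le> 2 * k \<Longrightarrow> tail_A n \<noteq> 0"
  using of_int_nonzero[of "2 * int k + 1 - int n"] k w_nonzero[of n] \<delta>_nonzero[of n]
  by (simp add: tail_A_def)

lemma tail_B_nonzero: "2 \<le> n \<Longrightarrow> n \<le> 2 * k \<Longrightarrow> tail_B n \<noteq> 0"
  using of_int_nonzero[of "1 - int n"] k w_nonzero[of n] \<delta>_nonzero[of n]
  by (simp add: tail_B_def)

lemma head_A_nonzero: "1 \<le> n \<Longrightarrow> n \<le> 2 * k \<Longrightarrow> head_A n \<noteq> 0"
  using of_nat_nonzero[of n] k w_nonzero[of n] \<delta>_nonzero[of n]
  by (simp add: head_A_def)

lemma head_B_nonzero: "1 \<le> n \<Longrightarrow> n < 2 * k \<Longrightarrow> head_B n \<noteq> 0"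
  using two_k_minus_nonzero[of n] w_nonzero[of n] \<delta>_nonzero[of n]
  by (simp add: head_B_def)

text \<open>Once \<open>inverse_wcoef\<close> has removed the reciprocal, only identities of
  numerators remain, such as 2k + 1 - n = \<open>\<delta> n\<close> + n.\<close>

lemma tail_head_rec:
  assumes n: "1 \<le> n" "n < 2 * k"
  shows "tail_A n = w n + 1 / tail_A (Suc n)" "tail_B n = w n + 1 / tail_B (Suc n)"
    "head_A (Suc n) = w (Suc n) + 1 / head_A n" "head_B (Suc n) = w (Suc n) + 1 / head_B n"
proof -
  let ?M = "2 * of_nat k - of_nat n :: 'a" and ?N = "of_nat n :: 'a"
  have nz: "\<delta> n \<noteq> 0" "\<delta> (Suc n) \<noteq> 0" "?M \<noteq> 0" "?N \<noteq> 0"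
    using n k \<delta>_nonzero[of n] \<delta>_nonzero[of "Suc n"] two_k_minus_nonzero[of n]
        of_nat_nonzero[of n]
    by simp_all
  have "1 / tail_A (Suc n) = \<delta> (Suc n) / ?M * (1 / w (Suc n))" by (simp add: tail_A_def)
  also have "\<dots> = ?N / \<delta> n * w n"
    unfolding inverse_wcoef(1)[OF n] using nz by (simp add: field_simps)
  finally have e: "1 / tail_A (Suc n) = ?N / \<delta> n * w n" .
  have "tail_A n = \<delta> n / \<delta> n * w n + ?N / \<delta> n * w n"
    unfolding tail_A_def minus_divide_left distrib_right[symmetric] add_divide_distrib[symmetric]
    by (simp add: \<delta>_def)
  then show "tail_A n = w n + 1 / tail_A (Suc n)" unfolding e using nz(1) by simp
  have "1 / tail_B (Suc n) = - (\<delta> (Suc n) / ?N) * (1 / w (Suc n))" by (simp add: tail_B_def)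
  also have "\<dots> = - (?M / \<delta> n) * w n"
    unfolding inverse_wcoef(1)[OF n] using nz by (simp add: field_simps)
  finally have e: "1 / tail_B (Suc n) = - (?M / \<delta> n) * w n" .
  have "tail_B n = \<delta> n / \<delta> n * w n + - (?M / \<delta> n) * w n"
    unfolding tail_B_def minus_divide_left distrib_right[symmetric] add_divide_distrib[symmetric]
    by (simp add: \<delta>_def)
  then show "tail_B n = w n + 1 / tail_B (Suc n)" unfolding e using nz(1) by simp
  have "1 / head_A n = - (\<delta> n / ?N) * (1 / w n)" by (simp add: head_A_def)
  also have "\<dots> = - (?M / \<delta> (Suc n)) * w (Suc n)"
    unfolding inverse_wcoef(2)[OF n] using nz by (simp add: field_simps)
  finally have e: "1 / head_A n = - (?M / \<delta> (Suc n)) * w (Suc n)" .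
  have "head_A (Suc n) = \<delta> (Suc n) / \<delta> (Suc n) * w (Suc n) + - (?M / \<delta> (Suc
      n)) * w (Suc n)"
    unfolding head_A_def minus_divide_left distrib_right[symmetric] add_divide_distrib[symmetric]
    by (simp add: \<delta>_def)
  then show "head_A (Suc n) = w (Suc n) + 1 / head_A n" unfolding e using nz(2) by simp
  have "1 / head_B n = \<delta> n / ?M * (1 / w n)" by (simp add: head_B_def)
  also have "\<dots> = ?N / \<delta> (Suc n) * w (Suc n)"
    unfolding inverse_wcoef(2)[OF n] using nz by (simp add: field_simps)
  finally have e: "1 / head_B n = ?N / \<delta> (Suc n) * w (Suc n)" .
  have "head_B (Suc n) = \<delta> (Suc n) / \<delta> (Suc n) * w (Suc n) + ?N / \<delta> (Suc n) *
      w (Suc n)"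
    unfolding head_B_def minus_divide_left distrib_right[symmetric] add_divide_distrib[symmetric]
    by (simp add: \<delta>_def)
  then show "head_B (Suc n) = w (Suc n) + 1 / head_B n" unfolding e using nz(2) by simp
qed

lemma wcoef_last_omega: "w (2 * k) = (1 - 2 * of_nat k) / (2 * of_nat k * omega k)"
  unfolding wcoef_last by (simp add: wcoef.simps minus_divide_left)

text \<open>The head values at 2k are the targets of the two types: with epsilon_1 = -epsilon_2,
  type A asks for -1/omega_k and type B for 0.\<close>

lemma tail_head_last:
  "tail_A (2 * k) = w (2 * k) + 1 / omega k" "tail_B (2 * k) = w (2 * k)"
  "head_A (2 * k) = - (1 / omega k)" "head_B (2 * k) = 0"
proof -
  have \<delta>: "\<delta> (2 * k) = 1 - 2 * of_nat k" by (simp add: \<delta>_def)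
  have nz: "1 - 2 * of_nat k \<noteq> (0 :: 'a)" "2 * of_nat k \<noteq> (0 :: 'a)"
    using \<delta>_nonzero[of "2 * k"] two_k_minus_nonzero[of 0] k unfolding \<delta> by auto
  show "tail_A (2 * k) = w (2 * k) + 1 / omega k"
    unfolding tail_A_def \<delta> wcoef_last_omega using nz omega_nonzero
    by (simp add: divide_simps) (simp add: algebra_simps)?
  show "tail_B (2 * k) = w (2 * k)" using nz by (simp add: tail_B_def \<delta>)
  show "head_A (2 * k) = - (1 / omega k)"
    unfolding head_A_def \<delta> wcoef_last_omega using nz omega_nonzero by (simp add: divide_simps)
  show "head_B (2 * k) = 0" by (simp add: head_B_def)
qed

lemma length_w_list [simp]: "length (w_list k n m) = Suc m - n"
  by (simp add: w_list_def del: upt_Suc)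

lemma nth_w_list: "i < Suc m - n \<Longrightarrow> w_list k n m ! i = w (n + i)"
  by (simp add: w_list_def del: upt_Suc)

lemma w_list_Cons: "n \<le> m \<Longrightarrow> w_list k n m = w n # w_list k (Suc n) m"
  unfolding w_list_def by (subst upt_conv_Cons) simp_all

lemma zero_notin_w_list: "1 \<le> n \<Longrightarrow> m \<le> 2 * k \<Longrightarrow> (0 :: 'a)
    \<notin> set (w_list k n m)"
  using w_nonzero by (auto simp: w_list_def simp del: upt_Suc)

context
  fixes j assumes j: "1 \<le> j" "j < 2 * k"
begin

lemma cfrac_w_list_omega:
  "cfrac (w_list k (Suc j) (2 * k) @ [omega k]) = tail_A (Suc j)"
  "cfrac_wd (w_list k (Suc j) (2 * k) @ [omega k] :: 'a list)"
proof -
  let ?cs = "w_list k (Suc j) (2 * k) @ [omega k] :: 'a list"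
  define v where "v = (\<lambda>i. if i < 2 * k - j then tail_A (Suc j + i) else omega k)"
  have cs: "cfrac (drop i ?cs) = v i" if "i < length ?cs" for i
  proof (rule cfrac_drop_eq[OF _ _ that])
    show "v (length ?cs - 1) = ?cs ! (length ?cs - 1)" by (simp add: v_def nth_append)
    fix i assume i: "Suc i < length ?cs"
    show "v i = ?cs ! i + 1 / v (Suc i)"
    proof (cases "Suc i < 2 * k - j")
      case True
      then show ?thesis using tail_head_rec(1)[of "Suc j + i"] by (simp add: v_def nth_append
          nth_w_list)
    next
      case False
      with i have "Suc j + i = 2 * k" using j by simp
      then show ?thesis using False i tail_head_last(1) by (simp add: v_def nth_append nth_w_list)
    qed
  qed
  from cs[of 0] show "cfrac ?cs = tail_A (Suc j)" using j by (simp add: v_def)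
  have "v i \<noteq> 0" for i using tail_A_nonzero omega_nonzero by (simp add: v_def)
  with cs show "cfrac_wd ?cs" unfolding cfrac_wd_def by (simp del: length_w_list length_append)
qed

lemma cfrac_w_list:
  "cfrac (w_list k (Suc j) (2 * k)) = tail_B (Suc j)"
  "cfrac_wd (w_list k (Suc j) (2 * k) :: 'a list)"
proof -
  let ?cs = "w_list k (Suc j) (2 * k) :: 'a list"
  define v where "v = (\<lambda>i. tail_B (Suc j + i))"
  have cs: "cfrac (drop i ?cs) = v i" if "i < length ?cs" for i
  proof (rule cfrac_drop_eq[OF _ _ that])
    show "v (length ?cs - 1) = ?cs ! (length ?cs - 1)"
      using j tail_head_last(2) by (simp add: v_def nth_w_list)
    fix i assume i: "Suc i < length ?cs"
    then show "v i = ?cs ! i + 1 / v (Suc i)"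
      using tail_head_rec(2)[of "Suc j + i"] by (simp add: v_def nth_w_list)
  qed
  from cs[of 0] show "cfrac ?cs = tail_B (Suc j)" using j by (simp add: v_def)
  \<comment> \<open>\<open>tail_B\<close> vanishes at index 1, which j >= 1 keeps out of the
    list.\<close>
  have "v i \<noteq> 0" if "i < length ?cs" for i
    using that j tail_B_nonzero[of "Suc j + i"] by (simp add: v_def)
  moreover have "length ?cs > 0" using j by simp
  then have "?cs \<noteq> []" by (simp only: length_greater_0_conv not_False_eq_True)
  ultimately show "cfrac_wd ?cs" using cs unfolding cfrac_wd_def by simp
qed

text \<open>The list is w_{2k}, ..., w_{j+2}, w_{j+1} - x, so evaluation from its end runs through
  increasing indices, as the head recursion does.\<close>

lemma perfect_list_drop:
  assumes x: "w (Suc j) - x = v (Suc j)"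
    and rec: "\<And>n. 1 \<le> n \<Longrightarrow> n < 2 * k \<Longrightarrow> v (Suc n) = w (Suc
        n) + 1 / v n"
  shows "length (perfect_list (w_list k (Suc j) (2 * k)) x) = 2 * k - j"
    and "i < 2 * k - j \<Longrightarrow> cfrac (drop i (perfect_list (w_list k (Suc j) (2 * k)) x))
        = v (2 * k - i)"
proof -
  let ?cs = "perfect_list (w_list k (Suc j) (2 * k)) x"
  have cs: "?cs = rev (w_list k (Suc (Suc j)) (2 * k)) @ [w (Suc j) - x]"
    using j by (simp add: perfect_list_def w_list_Cons)
  show len: "length ?cs = 2 * k - j" using j by (simp add: cs)
  have nth: "?cs ! i = w (2 * k - i)" if "Suc i < 2 * k - j" for i
  proof -
    have "rev (w_list k (Suc (Suc j)) (2 * k)) ! i = w_list k (Suc (Suc j)) (2 * k) ! (2 * k - Suc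
        j - Suc i)"
      using that by (subst rev_nth) auto
    also have "\<dots> = w (Suc (Suc j) + (2 * k - Suc j - Suc i))"
      using that by (intro nth_w_list) simp
    also have "Suc (Suc j) + (2 * k - Suc j - Suc i) = 2 * k - i" using that by simp
    finally show ?thesis using that by (simp add: cs nth_append less_diff_conv)
  qed
  assume i: "i < 2 * k - j"
  show "cfrac (drop i ?cs) = v (2 * k - i)"
  proof (rule cfrac_drop_eq[where v = "\<lambda>i. v (2 * k - i)"])
    show "v (2 * k - (length ?cs - 1)) = ?cs ! (length ?cs - 1)"
    proof -
      have "2 * k - (length ?cs - 1) = Suc j" using j by (simp add: len)
      moreover have "?cs ! (length ?cs - 1) = w (Suc j) - x" unfolding cs by (simp add: nth_append)
      ultimately show ?thesis using x by simp
    qed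
    fix i assume "Suc i < length ?cs"
    then have i: "Suc i < 2 * k - j" by (simp add: len)
    then have "2 * k - i = Suc (2 * k - Suc i)" by simp
    then show "v (2 * k - i) = ?cs ! i + 1 / v (2 * k - Suc i)"
      using rec[of "2 * k - Suc i"] nth[OF i] i j by simp
  qed (use i len in simp)
qed

text \<open>The last entry of the list is \<open>head_A (Suc j)\<close>, and the recursion carries
  it up to \<open>head_A (2 * k)\<close>, which is -1/omega_k.\<close>

lemma perfect_A_tail:
  "perfect_A k (w_list k (Suc j) (2 * k)) (- tail_A (Suc j)) (tail_A (Suc j))"
proof -
  let ?cs = "perfect_list (w_list k (Suc j) (2 * k)) (tail_A (Suc j))"
  have x: "w (Suc j) - tail_A (Suc j) = head_A (Suc j)" using j by (intro tail_head) auto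
  note * = perfect_list_drop[OF x tail_head_rec(3)]
  have A0: "tail_A (Suc j) \<noteq> 0" using j by (intro tail_A_nonzero) auto
  have "cfrac (drop i ?cs) \<noteq> 0" if "0 < i" "i < length ?cs" for i
    using that j *(2)[of i] *(1) head_A_nonzero[of "2 * k - i"] by simp
  moreover have "?cs \<noteq> []" by (simp add: perfect_list_def)
  moreover have "cfrac ?cs = - tail_A (Suc j) / (tail_A (Suc j) * omega k)"
    using *(2)[of 0] j tail_head_last(3) A0 by simp
  ultimately show ?thesis using A0 unfolding perfect_A_def cfrac_wd_def by blast
qed

text \<open>Among the indices from 1 to 2k, \<open>head_B\<close> vanishes only at 2k, that is, for
  the full list; its proper tails stay nonzero.\<close>

lemma perfect_B_tail: "perfect_B (w_list k (Suc j) (2 * k)) (tail_B (Suc j))"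
proof -
  let ?cs = "perfect_list (w_list k (Suc j) (2 * k)) (tail_B (Suc j))"
  have x: "w (Suc j) - tail_B (Suc j) = head_B (Suc j)" using j by (intro tail_head) auto
  note * = perfect_list_drop[OF x tail_head_rec(4)]
  have "cfrac (drop i ?cs) \<noteq> 0" if "0 < i" "i < length ?cs" for i
    using that j *(2)[of i] *(1) head_B_nonzero[of "2 * k - i"] by simp
  moreover have "?cs \<noteq> []" by (simp add: perfect_list_def)
  moreover have "cfrac ?cs = 0" using *(2)[of 0] j tail_head_last(4) by simp
  ultimately show ?thesis unfolding perfect_B_def cfrac_wd_def by blast
qed

text \<open>The symmetry of the w_i reduces the product to the relation for w_{j+1} w_j. Hence
  inverting a special value of \<epsilon> for j gives the one for 2k - j, and \<beta> is perfect
  together with \<alpha>.\<close>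

lemma tail_reflect:
  "tail_A (Suc j) * tail_A (Suc (2 * k - j)) = 1" "tail_B (Suc j) * tail_B (Suc (2 * k - j)) = 1"
proof -
  let ?J = "of_nat j :: 'a" and ?K = "of_nat k :: 'a"
  have w: "w (Suc (2 * k - j)) = - w j" using wcoef_sym[of j] j by (simp add: Suc_diff_le)
  have of2: "of_nat (2 * k - j) = 2 * ?K - ?J" using j by (simp add: of_nat_diff)
  have \<delta>: "\<delta> (Suc (2 * k - j)) = - \<delta> j" by (simp add: \<delta>_def of2)
  have nz: "\<delta> j \<noteq> 0" "\<delta> (Suc j) \<noteq> 0" using j \<delta>_nonzero[of j]
      \<delta>_nonzero[of "Suc j"] by simp_all
  have rel: "w (Suc j) * w j * (?J * (2 * ?K - ?J)) = \<delta> j * \<delta> (Suc j)"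
    using w_rel[of j] j by (simp add: \<delta>_def algebra_simps)
  have "tail_A (Suc j) * tail_A (Suc (2 * k - j))
      = (2 * ?K - ?J) / \<delta> (Suc j) * w (Suc j) * (?J / \<delta> j * w j)"
    by (simp add: tail_A_def w \<delta> of2)
  also have "\<dots> = w (Suc j) * w j * (?J * (2 * ?K - ?J)) / (\<delta> j * \<delta> (Suc j))" by
      (simp add: mult_ac)
  finally show "tail_A (Suc j) * tail_A (Suc (2 * k - j)) = 1" unfolding rel using nz by simp
  have "tail_B (Suc j) * tail_B (Suc (2 * k - j))
      = - ?J / \<delta> (Suc j) * w (Suc j) * (- (2 * ?K - ?J) / \<delta> j * w j)"
    by (simp add: tail_B_def w \<delta> of2)
  also have "\<dots> = w (Suc j) * w j * (?J * (2 * ?K - ?J)) / (\<delta> j * \<delta> (Suc j))" by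
      (simp add: algebra_simps diff_divide_distrib)
  finally show "tail_B (Suc j) * tail_B (Suc (2 * k - j)) = 1" unfolding rel using nz by simp
qed

lemma tail_A_neq_tail_B: "tail_A (Suc j) \<noteq> tail_B (Suc j)"
proof -
  have "tail_A (Suc j) - tail_B (Suc j) = 2 * of_nat k / \<delta> (Suc j) * w (Suc j)"
    unfolding tail_A_def tail_B_def left_diff_distrib[symmetric] diff_divide_distrib[symmetric] by simp
  also have "\<dots> \<noteq> 0"
    using two_k_minus_nonzero[of 0] \<delta>_nonzero[of "Suc j"] w_nonzero[of "Suc j"] j k by simp
  finally show ?thesis by auto
qed

end

end

section \<open>The polynomial \<open>H\<close>\<close>

lemma eval_series_0 [simp]: "eval_series 0 x = 0"
  by (simp add: eval_series_def)

lemma eval_series_pCons: "eval_series (pCons c F) x = poly_to_series c + x * eval_series F x"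
  by (cases "pCons c F = 0") (auto simp: eval_series_def)

lemma eval_series_add: "eval_series (F + G) x = eval_series F x + eval_series G x"
proof (induction F G rule: poly_induct2)
  case (pCons a p b q)
  then show ?case by (simp add: eval_series_pCons poly_to_series_add algebra_simps)
qed simp

lemma eval_series_smult: "eval_series (Polynomial.smult c F) x = poly_to_series c * eval_series F x"
  by (induction F) (simp_all add: eval_series_pCons poly_to_series_mult algebra_simps)

lemma eval_series_diff: "eval_series (F - G) x = eval_series F x - eval_series G x"
  using eval_series_add[of "F - G" G x] by simp

lemma eval_series_mult: "eval_series (F * G) x = eval_series F x * eval_series G x"
  by (induction F) (simp_all add: eval_series_pCons eval_series_add eval_series_smult distrib_right
      mult.assoc mult_pCons_left)

lemma eval_series_monom: "eval_series (Polynomial.monom c n) x = poly_to_series c * x ^ n"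
  by (induction n) (simp_all add: monom_0 monom_Suc eval_series_pCons)

lemma eval_series_H_poly:
  "eval_series (H_poly p k j e) x
    = poly_to_series (K_poly k (j + 2) (2 * k)) * x ^ Suc p - poly_to_series (K_poly k (j + 1) (2 *
        k)) * x ^ p
      + fls_const e * (poly_to_series (K_poly k 1 j) * x + poly_to_series (K_poly k 1 (j - 1)))"
  by (simp add: H_poly_def eval_series_add eval_series_diff eval_series_smult eval_series_monom
      poly_to_series_const)

text \<open>The coefficients will lie in F_p[T], which is not a field, but division by a monic
  polynomial is still possible.\<close>

lemma monic_quadratic_division:
  fixes F :: "'a::comm_ring_1 poly"
  shows "\<exists>q r s. F = q * [:b, a, 1:] + [:r, s:]"
proof (induction F)
  case 0
  show ?case by (rule exI[of _ 0], rule exI[of _ 0], rule exI[of _ 0]) simp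
next
  case (pCons c F)
  then obtain q r s where F: "F = q * [:b, a, 1:] + [:r, s:]" by blast
  have "pCons c F = (pCons s q) * [:b, a, 1:] + [:c - s * b, r - s * a:]"
    unfolding F by (simp add: mult_pCons_left)
  then show ?case by blast
qed

text \<open>A remainder r + s X with s nonzero would make x rational.\<close>

lemma quadratic_dvd_of_root:
  assumes irr: "\<not> fls_rational x" and root: "eval_series [:b, a, 1:] x = 0" "eval_series F x = 0"
  shows "[:b, a, 1:] dvd F"
proof -
  obtain q r s where F: "F = q * [:b, a, 1:] + [:r, s:]" using monic_quadratic_division by blast
  have eq: "poly_to_series r + x * poly_to_series s = 0"
    using root by (simp add: F eval_series_add eval_series_mult) (simp add: eval_series_pCons)
  have "s = 0"
  proof (rule ccontr)
    assume "s \<noteq> 0"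
    moreover have "poly_to_series s * x = poly_to_series (- r)"
      using eq by (simp add: poly_to_series_minus eq_neg_iff_add_eq_0 algebra_simps)
    ultimately show False using irr unfolding fls_rational_def by blast
  qed
  with eq have "r = 0" by simp
  with \<open>s = 0\<close> show ?thesis by (simp add: F)
qed

lemma infinite_cfrac_minus:
  assumes "infinite_cfrac a x"
  shows "infinite_cfrac (\<lambda>i. - a i) (- x)"
proof -
  have "cfrac (map uminus cs) = - cfrac cs" for cs :: "'b::field list"
    by (induction cs rule: cfrac.induct) simp_all
  from this[of "map (\<lambda>i. poly_to_series (a i)) [0..<Suc n]" for n]
  have eq: "cf_convergent (\<lambda>i. - a i) n = - cf_convergent a n" for n
    by (simp add: cf_convergent_def poly_to_series_minus o_def del: upt_Suc)
  have "cf_convergent a \<longlonglongrightarrow> x" using assms by (simp add: infinite_cfrac_iff)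
  then have "cf_convergent (\<lambda>i. - a i) \<longlonglongrightarrow> - x"
    by (rule tendsto_of_dist_le)
       (simp add: eq dist_conv_fls_abs fls_abs_minus_commute)
  then show ?thesis using assms by (simp add: infinite_cfrac_iff)
qed

context odd_char_field
begin

text \<open>A prefix of linear quotients acts on y as a Moebius map whose entries are continuants;
  the denominator is cleared. The prefix grows at its left end, hence the left recursion.\<close>

lemma linear_quotients_append_eq:
  assumes y: "fls_abs y > 1" and "r + d < 2 * k"
  shows "cfrac_append (linear_quotients (w_list k (Suc r) (Suc (r + d)))) y
      * (poly_to_series (K_poly k (Suc (Suc r)) (Suc (r + d))) * y + poly_to_series (K_poly k (Suc
          (Suc r)) (r + d)))
    = poly_to_series (K_poly k (Suc r) (Suc (r + d)) :: 'a poly) * y + poly_to_series (K_poly k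
        (Suc r) (r + d))"
  using assms(2)
proof (induction d arbitrary: r)
  case 0
  have "w_list k (Suc r) (Suc r) = [w (Suc r)]" by (simp add: w_list_def)
  moreover have "y \<noteq> 0" using y by auto
  ultimately show ?case
    by (simp add: K_poly_Suc_left K_poly_Suc_Suc_left K_poly_same field_simps)
next
  case (Suc d)
  let ?x = "cfrac_append (linear_quotients (w_list k (Suc (Suc r)) (Suc (r + Suc d)))) y"
  have W: "w_list k (Suc r) (Suc (r + Suc d)) = w (Suc r) # w_list k (Suc (Suc r)) (Suc (r + Suc d))"
    by (rule w_list_Cons) simp
  have "fls_abs ?x > 1"
    using zero_notin_w_list[of "Suc (Suc r)" "Suc (r + Suc d)"] Suc.prems
    by (intro fls_abs_cfrac_append y) auto
  then have x0: "?x \<noteq> 0" by auto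
  have rec: "K_poly k (Suc r) (Suc (r + Suc d)) = [:0, w (Suc r):] * K_poly k (Suc (Suc r)) (Suc (r
      + Suc d))
        + K_poly k (Suc (Suc (Suc r))) (Suc (r + Suc d))"
      "K_poly k (Suc r) (r + Suc d) = [:0, w (Suc r):] * K_poly k (Suc (Suc r)) (r + Suc d)
        + K_poly k (Suc (Suc (Suc r))) (r + Suc d)"
    using K_poly_rec_left[of k r "Suc d", where 'a = 'a] K_poly_rec_left[of k r d, where 'a = 'a]
        by simp_all
  define A where "A = poly_to_series (K_poly k (Suc (Suc r)) (Suc (r + Suc d)) :: 'a poly) * y
    + poly_to_series (K_poly k (Suc (Suc r)) (r + Suc d))"
  define B where "B = poly_to_series (K_poly k (Suc (Suc (Suc r))) (Suc (r + Suc d)) :: 'a poly) * y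
    + poly_to_series (K_poly k (Suc (Suc (Suc r))) (r + Suc d))"
  have "?x * B = A" using Suc.IH[of "Suc r"] Suc.prems by (simp add: A_def B_def)
  then have "(poly_to_series [:0, w (Suc r):] + 1 / ?x) * A = poly_to_series [:0, w (Suc r):] * A + B"
    using x0 by (simp add: field_simps)
  then show ?case
    unfolding W rec poly_to_series_add poly_to_series_mult A_def B_def
    by (simp add: algebra_simps)
qed

text \<open>Two instances of \<open>K_poly_det\<close>, in which K_{1,2k} and K_{1,2k-1} are P_k and
  R_k up to sign.\<close>

lemma K_poly_PR:
  assumes j: "1 \<le> j" "j < 2 * k"
  shows "K_poly k 1 j = Polynomial.smult ((- 1) ^ (k + j))
      (P_poly k * K_poly k (Suc (Suc j)) (2 * k - 1) + R_poly p k * K_poly k (Suc (Suc j)) (2 * k)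
          :: 'a poly)"
    and "K_poly k 1 (j - 1) = - Polynomial.smult ((- 1) ^ (k + j))
      (P_poly k * K_poly k (Suc j) (2 * k - 1) + R_poly p k * K_poly k (Suc j) (2 * k) :: 'a poly)"
proof -
  have S: "Suc (2 * k - 1) = 2 * k" using j by simp
  have PR: "P_poly k = (- 1) ^ k * (K_poly k 1 (2 * k) :: 'a poly)"
    "R_poly p k = - ((- 1) ^ k * (K_poly k 1 (2 * k - 1) :: 'a poly))"
    unfolding K_poly_full_eq K_poly_penultimate_eq by (cases "even k"; simp)+
  have sgn: "Polynomial.smult ((- 1) ^ n) f = (- 1) ^ n * f" for n and f :: "'a poly"
    by (cases "even n") simp_all
  have main: "Polynomial.smult ((- 1) ^ (k + j)) (P_poly k * X + R_poly p k * Y)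
      = (- 1) ^ j * (K_poly k 1 (2 * k) * X - K_poly k 1 (2 * k - 1) * Y)" for X Y :: "'a poly"
    unfolding sgn PR by (cases "even k") (simp_all add: power_add algebra_simps)
  obtain e where e: "2 * k - 1 = j + e" using j by (metis S less_Suc_eq_le le_Suc_ex)
  have par: "(- 1 :: 'a poly) ^ Suc e = (- 1) ^ j" 
  proof -
    have "even (j + Suc e)" using e S by presburger
    then show ?thesis by (cases "even j") auto
  qed
  have "K_poly k 1 (2 * k) * K_poly k (Suc (Suc j)) (2 * k - 1) - K_poly k 1 (2 * k - 1) * K_poly k
      (Suc (Suc j)) (2 * k)
      = (- 1) ^ Suc e * (K_poly k 1 j :: 'a poly)"
    using K_poly_det[of k j e, where 'a = 'a] unfolding e[symmetric] S .
  then show "K_poly k 1 j = Polynomial.smult ((- 1) ^ (k + j))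
      (P_poly k * K_poly k (Suc (Suc j)) (2 * k - 1) + R_poly p k * K_poly k (Suc (Suc j)) (2 * k)
          :: 'a poly)"
    unfolding main par by (cases "even j") simp_all
  obtain i where i: "j = Suc i" using j by (cases j) auto
  have e': "2 * k - 1 = i + Suc e" using e i by simp
  have "K_poly k 1 (2 * k) * K_poly k (Suc j) (2 * k - 1) - K_poly k 1 (2 * k - 1) * K_poly k (Suc
      j) (2 * k)
      = (- 1) ^ Suc (Suc e) * (K_poly k 1 i :: 'a poly)"
    using K_poly_det[of k i "Suc e", where 'a = 'a] unfolding e'[symmetric] i[symmetric] S .
  also have "(- 1 :: 'a poly) ^ Suc (Suc e) = (- 1) ^ Suc j" using par by simp
  finally show "K_poly k 1 (j - 1) = - Polynomial.smult ((- 1) ^ (k + j))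
      (P_poly k * K_poly k (Suc j) (2 * k - 1) + R_poly p k * K_poly k (Suc j) (2 * k) :: 'a poly)"
    unfolding main by (cases "even j") (simp_all add: i)
qed

lemma eval_series_H_poly_expansion:
  fixes \<epsilon> :: 'a
  assumes j: "1 \<le> j" "j < 2 * k" 
    and "P_expansion_by p k (w_list k (Suc j) (2 * k)) ((- 1) ^ (k + j) * \<epsilon>) (- ((- 1) ^
        (k + j) * \<epsilon>)) x"
  shows "eval_series (H_poly p k j \<epsilon>) x = 0"
proof -
  let ?p = "poly_to_series :: 'a poly \<Rightarrow> 'a fls"
  define s where "s = fls_const ((- 1) ^ (k + j) :: 'a)"
  define e where "e = fls_const \<epsilon>"
  obtain y where y: "fls_abs y > 1" and x: "x = cfrac_append (linear_quotients (w_list k (Suc j) (2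
      * k))) y"
    and xp: "x ^ p = s * e * (?p (P_poly k) * y - ?p (R_poly p k))"
    using P_expansion_by_imp[OF assms(3)] unfolding s_def e_def
    by (auto simp: fls_const_mult_const fls_const_uminus algebra_simps simp flip: fls_const_mult_const)
  define A where "A = ?p (K_poly k (Suc (Suc j)) (2 * k))"
  define A' where "A' = ?p (K_poly k (Suc (Suc j)) (2 * k - 1))"
  define B where "B = ?p (K_poly k (Suc j) (2 * k))"
  define B' where "B' = ?p (K_poly k (Suc j) (2 * k - 1))"
  define P where "P = ?p (P_poly k)"
  define R where "R = ?p (R_poly p k)"
  have S: "Suc (2 * k - 1) = 2 * k" using j by simp
  obtain d where d: "2 * k - 1 = j + d" using j by (metis S less_Suc_eq_le le_Suc_ex)
  have mob: "x * (A * y + A') = B * y + B'"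
    using linear_quotients_append_eq[OF y, of j d] j S
    unfolding d[symmetric] A_def A'_def B_def B'_def x by simp
  have C: "?p (K_poly k 1 j) = s * (P * A' + R * A)" "?p (K_poly k 1 (j - 1)) = - (s * (P * B' + R
      * B))"
    unfolding K_poly_PR[OF j] s_def A_def A'_def B_def B'_def P_def R_def by (simp_all add:
        poly_to_series_hom)
  have "eval_series (H_poly p k j \<epsilon>) x = (A * x - B) * x ^ p + e * (s * (P * A' + R * A) *
      x - s * (P * B' + R * B))"
    unfolding eval_series_H_poly C e_def[symmetric] by (simp add: A_def B_def algebra_simps)
  \<comment> \<open>After substitution of x^p the terms in R_k cancel, and a multiple of the Moebius
    relation is left.\<close>
  also have "\<dots> = s * e * P * (x * (A * y + A') - (B * y + B'))"
    unfolding xp P_def[symmetric] R_def[symmetric] by (simp add: algebra_simps)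
  also have "\<dots> = 0" unfolding mob by simp
  finally show ?thesis .
qed

text \<open>By the symmetry $w_{2k+1-i} = -w_i$, the polynomial for $(2k - j, \epsilon^{-1})$ is,
    up to a constant, the reciprocal of $H$.\<close>

lemma eval_series_H_poly_reciprocal:
  fixes \<epsilon> :: 'a
  assumes j: "1 \<le> j" "j < 2 * k" and "\<epsilon> \<noteq> 0" "x \<noteq> 0"
    and root: "eval_series (H_poly p k (2 * k - j) (inverse \<epsilon>)) x = 0"
  shows "eval_series (H_poly p k j \<epsilon>) (1 / x) = 0"
proof -
  let ?p = "poly_to_series :: 'a poly \<Rightarrow> 'a fls"
  define A where "A = ?p (K_poly k (Suc (Suc j)) (2 * k))"
  define B where "B = ?p (K_poly k (Suc j) (2 * k))"
  define C where "C = ?p (K_poly k 1 j)"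
  define D where "D = ?p (K_poly k 1 (j - 1))"
  define \<sigma> :: "'a fls" where "\<sigma> = (- 1) ^ j"
  have \<sigma>: "\<sigma> * \<sigma> = 1" unfolding \<sigma>_def by (cases "even j") simp_all
  have hom: "?p ((- 1) ^ n * f) = (- 1) ^ n * ?p f" for n f
    by (simp add: poly_to_series_hom)
  have e1: "?p (K_poly k (2 * k - j + 1) (2 * k)) = \<sigma> * C"
    using K_poly_sym[of j] j by (simp add: \<sigma>_def C_def hom)
  have e2: "?p (K_poly k (2 * k - j + 2) (2 * k)) = - \<sigma> * D"
  proof -
    have "Suc (2 * k - (j - 1)) = 2 * k - j + 2" using j by simp
    moreover have "(- 1) ^ (j - 1) = - \<sigma>" using j by (cases j) (simp_all add: \<sigma>_def)
    ultimately show ?thesis using K_poly_sym[of "j - 1"] j by (simp add: D_def hom)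
  qed
  have e3: "?p (K_poly k 1 (2 * k - j)) = \<sigma> * B"
  proof -
    have "(- 1) ^ (2 * k - j) = \<sigma>" unfolding \<sigma>_def using j by (cases "even j") simp_all
    moreover have "Suc (2 * k - (2 * k - j)) = Suc j" using j by simp
    ultimately have "B = \<sigma> * ?p (K_poly k 1 (2 * k - j))"
      using K_poly_sym[of "2 * k - j"] by (simp add: B_def hom)
    then show ?thesis using \<sigma> by (simp flip: mult.assoc)
  qed
  have e4: "?p (K_poly k 1 (2 * k - j - 1)) = - \<sigma> * A"
  proof -
    have "(- 1) ^ (2 * k - j - 1) = - \<sigma>"
      unfolding \<sigma>_def using j by (cases "even j") simp_all
    moreover have "Suc (2 * k - (2 * k - j - 1)) = Suc (Suc j)" using j by simp
    ultimately have "A = - \<sigma> * ?p (K_poly k 1 (2 * k - j - 1))"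
      using K_poly_sym[of "2 * k - j - 1"] by (simp add: A_def hom)
    then show ?thesis using \<sigma> by (simp flip: mult.assoc)
  qed
  have "\<sigma> * (- D * x ^ Suc p - C * x ^ p + fls_const (inverse \<epsilon>) * (B * x - A)) = 0"
    using root unfolding eval_series_H_poly e1 e2 e3 e4 by (simp add: algebra_simps)
  moreover have "\<sigma> \<noteq> 0" using \<sigma> by auto
  ultimately have *: "- D * x ^ Suc p - C * x ^ p + fls_const (inverse \<epsilon>) * (B * x - A) =
      0" by simp
  have inv: "fls_const \<epsilon> * fls_const (inverse \<epsilon>) = 1"
    using \<open>\<epsilon> \<noteq> 0\<close> by (simp add: fls_const_mult_const)
  \<comment> \<open>Multiplication by x^(p+1) produces the reciprocal polynomial, which is
    -\<epsilon> times the expression known to vanish.\<close>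
  have "x ^ Suc p * eval_series (H_poly p k j \<epsilon>) (1 / x) = A - B * x + fls_const
      \<epsilon> * (C * x ^ p + D * x ^ Suc p)"
    unfolding eval_series_H_poly using \<open>x \<noteq> 0\<close>
    by (simp add: A_def B_def C_def D_def field_simps)
  also have "\<dots> = - fls_const \<epsilon> * (- D * x ^ Suc p - C * x ^ p + fls_const (inverse
      \<epsilon>) * (B * x - A))
      + (fls_const \<epsilon> * fls_const (inverse \<epsilon>) - 1) * (B * x - A)"
    by (simp add: algebra_simps del: fls_const_mult_const)
  also have "\<dots> = 0" unfolding * inv by simp
  finally show ?thesis using \<open>x \<noteq> 0\<close> by simp
qed

end

section \<open>The case $k = (p-1)/2$\<close>

context odd_char_field
begin

context
  assumes half: "p = Suc (2 * k)"
begin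

lemma two_k_eq: "2 * of_nat k = (- 1 :: 'a)"
proof -
  have "of_nat (Suc (2 * k)) = (0 :: 'a)" using char half by (metis of_nat_CHAR)
  then show ?thesis by (simp add: add.commute eq_neg_iff_add_eq_0)
qed

lemma omega_half: "omega k = (- 1 :: 'a)"
proof -
  have "(- 1) ^ k * (\<Prod>i = 1..k. 1 - 1 / of_nat (2 * i) :: 'a) = 1"
    using central_binomial_eq[OF half order.refl] by simp
  moreover have "(- 1 :: 'a) ^ k = - ((- 1) ^ (k - 1))" using k by (cases k) simp_all
  ultimately show ?thesis by (simp add: omega_def minus_equation_iff)
qed

text \<open>With 2k = -1 in the field the relation collapses to w_{i+1} w_i = -4, starting from w_1
  = -2.\<close>

lemma wcoef_half: "1 \<le> i \<Longrightarrow> i \<le> 2 * k \<Longrightarrow> w i = 2 * (- 1) ^ i"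
proof (induction i rule: nat_induct_at_least)
  case base
  show ?case using two_k_eq by (simp add: wcoef.simps omega_half)
next
  case (Suc i)
  have "w (Suc i) * w i * (of_nat i * (- 1 - of_nat i)) = (- 1 - 2 * of_nat i - 1) * (- 1 - 2 *
      of_nat i + 1)"
    using w_rel[of i] Suc unfolding two_k_eq by simp
  also have "\<dots> = - 4 * (of_nat i * (- 1 - of_nat i))" by (simp add: algebra_simps)
  finally have "w (Suc i) * w i * (of_nat i * (- 1 - of_nat i)) = - 4 * (of_nat i * (- 1 - of_nat i))" .
  then have "w (Suc i) * w i = - 4"
  proof (rule mult_right_cancel[THEN iffD1, rotated])
    show "of_nat i * (- 1 - of_nat i) \<noteq> (0 :: 'a)"
      using of_nat_nonzero[of i] of_int_nonzero[of "- 1 - int i"] Suc k by simp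
  qed
  also have "\<dots> = 2 * (- 1) ^ Suc i * (2 * (- 1) ^ i)" by (cases "even i") simp_all
  also have "w i = 2 * (- 1) ^ i" using Suc by simp
  finally have "w (Suc i) * (2 * (- 1) ^ i) = 2 * (- 1) ^ Suc i * (2 * (- 1) ^ i)" .
  moreover have "2 * (- 1) ^ i \<noteq> (0 :: 'a)" using two_nonzero by simp
  ultimately show ?case by (rule mult_right_cancel[THEN iffD1, rotated])
qed

text \<open>As 2k + 1 = 0 in the field, the factor of w_n in \<open>tail_A n\<close> is 1/2. It
  follows that epsilon_1 = (-1)^j when \<epsilon> is the type A value.\<close>

lemma tail_A_half:
  assumes "1 \<le> j" "j < 2 * k"
  shows "tail_A (Suc j) = (- 1) ^ Suc j"
proof -
  have nz: "of_nat (Suc j) \<noteq> (0 :: 'a)" using assms k by (intro of_nat_nonzero) auto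
  have "tail_A (Suc j) = (- of_nat (Suc j)) / (- (2 * of_nat (Suc j))) * (2 * (- 1) ^ Suc j)"
    using assms by (simp add: tail_A_def \<delta>_def two_k_eq wcoef_half)
  also have "\<dots> = (- 1) ^ Suc j" using nz two_nonzero by (simp add: field_simps del: of_nat_Suc)
  finally show ?thesis .
qed

text \<open>Now h = k, and the expansion of T (Q + 1)^k loses only its top term to the reduction
  modulo Q^k.\<close>

lemma R_poly_half: "R_poly p k = poly_T ^ p - poly_T * (P_poly k :: 'a poly)"
proof -
  have "poly_T ^ p = poly_T * (poly_T\<^sup>2 - 1 + 1 :: 'a poly) ^ k"
    by (simp add: half power_mult)
  also have "(poly_T\<^sup>2 - 1 + 1 :: 'a poly) ^ k = (\<Sum>i<Suc k. of_nat (k choose i) *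
      (poly_T\<^sup>2 - 1) ^ i)"
    using binomial_ring[of "poly_T\<^sup>2 - 1 :: 'a poly" 1 k]
    by (simp only: lessThan_Suc_atMost power_one mult_1_right)
  finally show ?thesis unfolding R_poly_eq_sum[OF half] by (simp add: P_poly_def distrib_left)
qed

end

end

text \<open>Shifting the quotients by one changes all signs, so the complete quotient is -\<rho> and
  \<rho> = -2T - 1/\<rho>.\<close>

lemma alternating_cfrac_exists:
  assumes two: "(2 :: 'a::field) \<noteq> 0"
  defines "a \<equiv> (\<lambda>i. if even i then [:0, - 2:] else [:0, 2 :: 'a:])"
  shows "\<exists>\<rho>. infinite_cfrac a \<rho> \<and> \<rho>\<^sup>2 + 2 * (fls_X_inv * \<rho>)
      + 1 = 0"
proof -
  have "degree (a i) > 0" for i using two by (simp add: a_def)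
  then obtain \<rho> where \<rho>: "infinite_cfrac a \<rho>" using infinite_cfrac_exists by blast
  have "(\<lambda>i. - a i) = (\<lambda>i. a (Suc i))" by (auto simp: a_def)
  with infinite_cfrac_minus[OF \<rho>] have "infinite_cfrac (\<lambda>i. a (Suc i)) (- \<rho>)" by simp
  from infinite_cfrac_cons[OF _ this] \<rho> have "infinite_cfrac a (poly_to_series (a 0) + 1 / -
      \<rho>)"
    by (simp add: infinite_cfrac_iff)
  from infinite_cfrac_unique[OF \<rho> this] have eq: "\<rho> = poly_to_series (a 0) + 1 / - \<rho>" .
  have "poly_to_series (a 0) = - 2 * fls_X_inv"
  proof -
    have "fls_const (2 :: 'a) = 2" by (metis fls_const_numeral numeral_One)
    then show ?thesis by (simp add: a_def poly_to_series_pCons fls_const_uminus mult.commute)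
  qed
  with eq have "\<rho> = - 2 * fls_X_inv - 1 / \<rho>" by simp
  moreover have "\<rho> \<noteq> 0" using fls_abs_infinite_cfrac(2)[OF \<rho>] by auto
  ultimately have "\<rho> * \<rho> = - 2 * fls_X_inv * \<rho> - 1"
    by (metis (no_types, lifting) left_diff_distrib nonzero_eq_divide_eq)
  then have "\<rho>\<^sup>2 + 2 * (fls_X_inv * \<rho>) + 1 = 0" by (simp add: power2_eq_square)
  with \<rho> show ?thesis by blast
qed

context
  fixes p k j :: nat
  assumes card: "p = CARD('p::prime_card)" and odd: "odd p" and k: "1 \<le> k" "2 * k < p" and j:
      "1 \<le> j" "j < 2 * k"
begin

interpretation odd_char_field k p "TYPE('p mod_ring)"
  by standard (use card odd k in simp_all)

lemma P_expansion_alternating: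
  fixes \<rho> :: "'p mod_ring fls"
  defines "a \<equiv> (\<lambda>i. if even i then [:0, - 2:] else [:0, 2 :: 'p mod_ring:])"
  assumes half: "p = Suc (2 * k)" and \<rho>: "infinite_cfrac a \<rho>" "\<rho>\<^sup>2 + 2 *
      (fls_X_inv * \<rho>) + 1 = 0"
  shows "P_expansion_by p k (w_list k (Suc j) (2 * k)) ((- 1) ^ j) (- ((- 1) ^ j)) ((- 1) ^ j * \<rho>)"
proof -
  let ?T = "fls_X_inv :: 'p mod_ring fls"
  define b where "b = (\<lambda>i. if even j then a i else - a i)"
  have T: "poly_to_series poly_T = ?T" by (simp add: poly_to_series_pCons)
  have sq: "(\<rho> - (- ?T))\<^sup>2 = ?T\<^sup>2 - 1"
    using \<rho>(2) by (simp add: power2_eq_square algebra_simps)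
  \<comment> \<open>Frobenius for \<rho> + T; as p = 2k + 1, its p-th power is \<rho> + T times the
    k-th power of T^2 - 1.\<close>
  have "\<rho> ^ p - (- ?T) ^ p = (\<rho> - (- ?T)) ^ p"
    unfolding card by (rule fls_power_card_diff[symmetric])
  also have "\<dots> = (\<rho> - (- ?T)) * ((\<rho> - (- ?T))\<^sup>2) ^ k"
    by (simp add: half power_mult)
  also have "\<dots> = (\<rho> + ?T) * poly_to_series (P_poly k)"
    unfolding sq by (simp add: P_poly_def poly_to_series_hom T)
  also have "(- ?T) ^ p = - (?T ^ p)" using p by simp
  finally have "\<rho> ^ p = poly_to_series (P_poly k) * \<rho> - poly_to_series (R_poly p k)"
    unfolding R_poly_half[OF half] by (simp add: poly_to_series_hom T algebra_simps)
  then have eq: "((- 1) ^ j * \<rho>) ^ p = fls_const ((- 1) ^ j) * poly_to_series (P_poly k) * \<rho>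
      + fls_const (- ((- 1) ^ j)) * poly_to_series (R_poly p k)"
    using odd by (cases "even j") (simp_all add: fls_const_uminus algebra_simps)
  have b: "infinite_cfrac b ((- 1) ^ j * \<rho>)"
    using \<rho>(1) infinite_cfrac_minus[OF \<rho>(1)] by (cases "even j") (simp_all add: b_def)
  \<comment> \<open>2k - j has the parity of j, so for either sign the complete quotient is \<rho>
    itself.\<close>
  have "(\<lambda>i. b (2 * k - j + i)) = a"
    using j by (auto simp: b_def a_def fun_eq_iff)
  then have tl: "infinite_cfrac (\<lambda>i. b (length (w_list k (Suc j) (2 * k) :: 'p mod_ring
      list) + i)) \<rho>"
    using \<rho>(1) j by simp
  have "b i = [:0, w_list k (Suc j) (2 * k) ! i:]" if "i < length (w_list k (Suc j) (2 * k) :: 'p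
      mod_ring list)" for i
    using that wcoef_half[OF half, of "Suc j + i"]
    by (auto simp: nth_w_list b_def a_def)
  moreover have "w_list k (Suc j) (2 * k) \<noteq> ([] :: 'p mod_ring list)"
    using j by (simp add: w_list_Cons)
  ultimately show ?thesis
    unfolding P_expansion_by_def using zero_notin_w_list[of "Suc j" "2 * k"] b tl eq
    by (intro conjI exI[of _ b] exI[of _ \<rho>]) auto
qed

lemma P_expansion_by_irrational:
  assumes "e \<noteq> 0" and "P_expansion_by p k (w_list k (Suc j) (2 * k)) e e' x"
  shows "\<not> fls_rational (x :: 'p mod_ring fls)"
proof -
  from P_expansion_by_imp[OF assms(2)] obtain y where y: "fls_abs y > 1"
    "x = cfrac_append (linear_quotients (w_list k (Suc j) (2 * k))) y"
    "x ^ p = fls_const e * poly_to_series (P_poly k) * y + fls_const e' * poly_to_series (R_poly p k)"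
    by blast
  show ?thesis
    using P_expansion_irrational[OF _ k(2) _ _ y] zero_notin_w_list[of "Suc j" "2 * k"] j k
    by (simp add: w_list_Cons)
qed

end

theorem proposition5p1:
  fixes p k j :: nat and \<epsilon> :: "'p::prime_card mod_ring"
  assumes "p = CARD('p)" and "odd p"
    and "1 \<le> k" and "2 * k < p"
    and "1 \<le> j" and "j \<le> 2 * k - 1"
    and "\<epsilon> \<noteq> 0"
  shows
    "let s = (- 1) ^ (k + j) :: 'p mod_ring;
         ls\<^sub>\<alpha> = w_list k (j + 1) (2 * k);
         ls\<^sub>\<beta> = w_list k (2 * k - j + 1) (2 * k);
         cs\<^sub>A = w_list k (j + 1) (2 * k) @ [omega k];
         cs\<^sub>B = w_list k (j + 1) (2 * k);
         \<epsilon>\<^sub>A = (- 1) ^ (k + j + 1) * cfrac cs\<^sub>A;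
         \<epsilon>\<^sub>B = (- 1) ^ (k + j + 1) * cfrac cs\<^sub>B
     in \<exists>\<alpha> \<beta>.
       \<comment> \<open>(1): \<open>\<alpha>\<close> and \<open>\<beta>\<close> exist and are determined by their defining conditions\<close>
       (\<forall>x. P_expansion_by p k ls\<^sub>\<alpha> (s * \<epsilon>) (- (s * \<epsilon>)) x \<longleftrightarrow> x = \<alpha>) \<and>
       (\<forall>x. P_expansion_by p k ls\<^sub>\<beta> (s * inverse \<epsilon>) (- (s * inverse \<epsilon>)) x \<longleftrightarrow> x = \<beta>) \<and>
       P_expansion p k \<alpha> \<and> P_expansion p k \<beta> \<and>
       eval_series (H_poly p k j \<epsilon>) \<alpha> = 0 \<and>
       eval_series (H_poly p k j \<epsilon>) (1 / \<beta>) = 0 \<and>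
       \<comment> \<open>(2)\<close>
       cfrac_wd cs\<^sub>A \<and> cfrac_wd cs\<^sub>B \<and>
       \<epsilon>\<^sub>A \<noteq> 0 \<and> \<epsilon>\<^sub>B \<noteq> 0 \<and> \<epsilon>\<^sub>A \<noteq> \<epsilon>\<^sub>B \<and>
       (\<epsilon> = \<epsilon>\<^sub>A \<longrightarrow>
          perfect_A k ls\<^sub>\<alpha> (s * \<epsilon>) (- (s * \<epsilon>)) \<and>
          perfect_A k ls\<^sub>\<beta> (s * inverse \<epsilon>) (- (s * inverse \<epsilon>))) \<and>
       (\<epsilon> = \<epsilon>\<^sub>B \<longrightarrow>
          perfect_B ls\<^sub>\<alpha> (- (s * \<epsilon>)) \<and>
          perfect_B ls\<^sub>\<beta> (- (s * inverse \<epsilon>))) \<and>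
       \<comment> \<open>(3)\<close>
       (k = (p - 1) div 2 \<and> \<epsilon> = \<epsilon>\<^sub>A \<longrightarrow>
          (let P = [:1, [:0, 2 * (- 1) ^ j:], 1:] :: 'p mod_ring poly poly
           in P dvd H_poly p k j \<epsilon> \<and>
              (\<exists>\<rho>. infinite_cfrac (\<lambda>i. if even i then [:0, - 2:] else [:0, 2:]) \<rho> \<and>
                   \<alpha> = (- 1) ^ j * \<rho>) \<and>
              eval_series P \<alpha> = 0))"
proof -
  interpret odd_char_field k p "TYPE('p mod_ring)"
    by standard (use assms in simp_all)
  define s where "s = ((- 1) ^ (k + j) :: 'p mod_ring)"
  have ss: "s * s = 1" unfolding s_def by (cases "even (k + j)") simp_all
  then have s0: "s \<noteq> 0" by auto
  have j: "1 \<le> j" "j < 2 * k" and j': "1 \<le> 2 * k - j" "2 * k - j < 2 * k" using assms by auto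
  \<comment> \<open>The sign is the same for j and 2k - j, which lets the results for \<alpha> apply
    to \<beta> verbatim.\<close>
  have s': "s = (- 1) ^ (k + (2 * k - j))"
    unfolding s_def using j by (cases "even k"; cases "even j") simp_all
  let ?la = "w_list k (Suc j) (2 * k) :: 'p mod_ring list"
  let ?lb = "w_list k (Suc (2 * k - j)) (2 * k) :: 'p mod_ring list"
  have nonempty: "?la \<noteq> []" "?lb \<noteq> []" using j j' by (simp_all add: w_list_Cons)
  have "0 \<notin> set ?la" "0 \<notin> set ?lb" using zero_notin_w_list by simp_all
  then obtain \<alpha> \<beta> where
    \<alpha>: "\<And>x. P_expansion_by p k ?la (s * \<epsilon>) (- (s * \<epsilon>)) x
        \<longleftrightarrow> x = \<alpha>" and
    \<beta>: "\<And>x. P_expansion_by p k ?lb (s * inverse \<epsilon>) (- (s * inverse \<epsilon>))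
        x \<longleftrightarrow> x = \<beta>"
    using P_expansion_exists_unique[of p k ?la "s * \<epsilon>" "- (s * \<epsilon>)"]
      P_expansion_exists_unique[of p k ?lb "s * inverse \<epsilon>" "- (s * inverse \<epsilon>)"]
          assms nonempty s0
    by auto
  have A: "P_expansion_by p k ?la (s * \<epsilon>) (- (s * \<epsilon>)) \<alpha>" using \<alpha> by
      blast
  have B: "P_expansion_by p k ?lb (s * inverse \<epsilon>) (- (s * inverse \<epsilon>)) \<beta>"
      using \<beta> by blast
  have HA: "eval_series (H_poly p k j \<epsilon>) \<alpha> = 0"
    using A unfolding s_def by (rule eval_series_H_poly_expansion[OF j])
  have HB: "eval_series (H_poly p k j \<epsilon>) (1 / \<beta>) = 0"
  proof (rule eval_series_H_poly_reciprocal[OF j \<open>\<epsilon> \<noteq> 0\<close>])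
    show "eval_series (H_poly p k (2 * k - j) (inverse \<epsilon>)) \<beta> = 0"
      using B unfolding s' by (rule eval_series_H_poly_expansion[OF j'])
    show "\<beta> \<noteq> 0"
      using B fls_abs_infinite_cfrac(2) unfolding P_expansion_by_def by fastforce
  qed
  \<comment> \<open>The closed forms stand in for the continued fractions, and \<open>- s\<close> is
    (-1)^(k+j+1).\<close>
  define \<epsilon>A where "\<epsilon>A = - s * tail_A (Suc j)"
  define \<epsilon>B where "\<epsilon>B = - s * tail_B (Suc j)"
  have A0: "tail_A (Suc j) \<noteq> 0" "tail_B (Suc j) \<noteq> 0"
    using tail_A_nonzero[of "Suc j"] tail_B_nonzero[of "Suc j"] j by simp_all
  then have neq: "\<epsilon>A \<noteq> 0" "\<epsilon>B \<noteq> 0" "\<epsilon>A \<noteq> \<epsilon>B"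
    using s0 tail_A_neq_tail_B[OF j] by (simp_all add: \<epsilon>A_def \<epsilon>B_def)
  have PA: "\<epsilon> = \<epsilon>A \<longrightarrow> perfect_A k ?la (s * \<epsilon>) (- (s *
      \<epsilon>))
      \<and> perfect_A k ?lb (s * inverse \<epsilon>) (- (s * inverse \<epsilon>))" (is "_
          \<longrightarrow> ?R")
  proof
    assume that: "\<epsilon> = \<epsilon>A"
    have "s * \<epsilon> = - tail_A (Suc j)" using ss by (simp add: that \<epsilon>A_def flip:
        mult.assoc)
    moreover have "s * inverse \<epsilon> = - tail_A (Suc (2 * k - j))"
      using tail_reflect(1)[OF j] A0 s0 ss by (simp add: that \<epsilon>A_def field_simps)
    ultimately show ?R
      using perfect_A_tail[OF j] perfect_A_tail[OF j'] by simp
  qed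
  have PB: "\<epsilon> = \<epsilon>B \<longrightarrow> perfect_B ?la (- (s * \<epsilon>)) \<and>
      perfect_B ?lb (- (s * inverse \<epsilon>))" (is "_ \<longrightarrow> ?R")
  proof
    assume that: "\<epsilon> = \<epsilon>B"
    have "s * \<epsilon> = - tail_B (Suc j)" using ss by (simp add: that \<epsilon>B_def flip:
        mult.assoc)
    moreover have "s * inverse \<epsilon> = - tail_B (Suc (2 * k - j))"
      using tail_reflect(2)[OF j] A0 s0 ss by (simp add: that \<epsilon>B_def field_simps)
    ultimately show ?R
      using perfect_B_tail[OF j] perfect_B_tail[OF j'] by simp
  qed
  have half: "k = (p - 1) div 2 \<and> \<epsilon> = \<epsilon>A \<longrightarrow> [:1, [:0, 2 * (-
      1) ^ j:], 1:] dvd H_poly p k j \<epsilon> \<and>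
      (\<exists>\<rho>. infinite_cfrac (\<lambda>i. if even i then [:0, - 2:] else [:0, 2:]) \<rho>
          \<and> \<alpha> = (- 1) ^ j * \<rho>) \<and>
      eval_series [:1, [:0, 2 * (- 1) ^ j:], 1:] \<alpha> = 0" (is "_ \<longrightarrow> ?R")
  proof
    assume that: "k = (p - 1) div 2 \<and> \<epsilon> = \<epsilon>A"
    have half: "p = Suc (2 * k)" using that \<open>odd p\<close> by (auto elim: oddE)
    have "s * \<epsilon> = (- 1) ^ j"
      using ss tail_A_half[OF half j] by (simp add: that \<epsilon>A_def flip: mult.assoc)
    obtain \<rho> where \<rho>: "infinite_cfrac (\<lambda>i. if even i then [:0, - 2:] else [:0, 2
        :: 'p mod_ring:]) \<rho>"
      "\<rho>\<^sup>2 + 2 * (fls_X_inv * \<rho>) + 1 = 0"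
      using alternating_cfrac_exists[OF two_nonzero] by blast
    \<comment> \<open>Uniqueness: it is enough that (-1)^j \<rho> meets the conditions that define
      \<alpha>.\<close>
    have \<alpha>\<rho>: "\<alpha> = (- 1) ^ j * \<rho>"
      using P_expansion_alternating[OF assms(1-4) j half \<rho>] \<alpha> unfolding \<open>s *
          \<epsilon> = _\<close> by simp
    have "poly_to_series [:0, 2 * (- 1) ^ j:] = 2 * (- 1) ^ j * (fls_X_inv :: 'p mod_ring fls)"
    proof -
      have "fls_const (2 :: 'p mod_ring) = 2" by (metis fls_const_numeral numeral_One)
      then show ?thesis by (cases "even j") (simp_all add: poly_to_series_pCons fls_const_uminus
          mult.commute)
    qed
    then have root: "eval_series [:1, [:0, 2 * (- 1) ^ j:], 1:] \<alpha> = 0"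
      using \<rho>(2) by (cases "even j") (simp_all add: \<alpha>\<rho> eval_series_pCons
          power2_eq_square algebra_simps)
    have "\<not> fls_rational \<alpha>"
      using P_expansion_by_irrational[OF assms(1-4) j _ A] s0 \<open>\<epsilon> \<noteq> 0\<close>
          by simp
    then have "[:1, [:0, 2 * (- 1) ^ j:], 1:] dvd H_poly p k j \<epsilon>"
      using root HA by (rule quadratic_dvd_of_root)
    with root \<rho>(1) \<alpha>\<rho> show ?R by blast
  qed
  have eps: "(- 1) ^ Suc (k + j) * cfrac (?la @ [omega k]) = \<epsilon>A" "(- 1) ^ Suc (k + j) *
      cfrac ?la = \<epsilon>B"
    using cfrac_w_list_omega(1)[OF j] cfrac_w_list(1)[OF j] by (simp_all add: \<epsilon>A_def
        \<epsilon>B_def s_def)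
  have exp: "P_expansion p k \<alpha>" "P_expansion p k \<beta>"
    using A B unfolding P_expansion_def by blast+
  show ?thesis
    unfolding Let_def s_def[symmetric] Suc_eq_plus1[symmetric] eps
    by (intro exI[of _ \<alpha>] exI[of _ \<beta>] conjI allI \<alpha> \<beta> exp HA HB neq PA PB half
        cfrac_w_list_omega(2)[OF j] cfrac_w_list(2)[OF j])
qed

end
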